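(* Let $p$ be an odd prime number, $n\ge 1$ an integer, and let $D_{p^n}=C_{p^n}\rtimes C_2$ be the dihedral group of order $2p^n$ with regular representation $\rho\colon D_{p^n}\to\mathrm{GL}(2p^n,\mathbb{Z})$. Let $K$ be an oriented knot in $S^3$ with Alexander polynomial $\Delta_K(t)$. Then for every epimorphism $f\colon G(K)\to D_{p^n}$ we have $$\Delta_K^{\rho\circ f}(t)\equiv\left(\frac{\Delta_K(t)}{t-1}\cdot\frac{\Delta_K(-t)}{t+1}\right)^{p^n}\pmod p.$$
   Context: $C_m$ denotes the cyclic group of order $m$. Knot group: for an oriented knot $K\subset S^3$, $E_K=S^3\setminus\nu(K)$ is the complement of an open tubular neighborhood and $G(K)=\pi_1(E_K)$. Let $\phi\colon G(K)\to\mathbb{Z}=\langle t\rangle$ be the abelianization, sending an oriented meridian to $t$. Twisted Alexander polynomial (Wada): let $R$ be a Noetherian unique factorization domain with quotient field $Q$ and $\varrho\colon G(K)\to\mathrm{GL}(k,R)$ a representation. Fix a Wirtinger presentation $G(K)=\langle s_1,\dots,s_m\mid r_1,\dots,r_{m-1}\rangle$. Extend $s\mapsto\phi(s)\varrho(s)$ to a ring homomorphism $\mathbb{Z}[G(K)]\to\mathrm{Mat}(k,R[t^{\pm1}])$, and let $\Phi\colon\mathbb{Z}[F_m]\to\mathrm{Mat}(k,R[t^{\pm1}])$ be its composition with the surjection $\mathbb{Z}[F_m]\to\mathbb{Z}[G(K)]$, where $F_m=\langle s_1,\dots,s_m\rangle$ is free. Let $M$ be the $k(m-1)\times km$ matrix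 with blocks $\Phi(\partial r_i/\partial s_j)$ (Fox derivatives), and let $M_j$ be $M$ with the $j$-th block column removed. Then $$\Delta_K^{\varrho}(t)=\frac{\det M_j}{\det\Phi(s_j-1)}\in Q(t),$$ which is well defined up to multiplication by $\varepsilon t^l$ ($\varepsilon\in R^\times$, $l\in\mathbb{Z}$). Regular representation: for a finite group $G$, $\rho\colon G\to\mathrm{Aut}_{\mathbb{Z}}(\mathbb{Z}[G])\cong\mathrm{GL}(|G|,\mathbb{Z})$ is the permutation representation given by the action of $G$ on itself by right multiplication (matrices acting on row vectors). "mod $p$" means reduction modulo $p$ of each integer coefficient (of numerator and denominator), so the congruence is an equality in $\mathbb{F}_p(t)$; as usual, it is understood up to multiplication by units $\varepsilon t^l$ ($\varepsilon\in\mathbb{F}_p^\times$, $l\in\mathbb{Z}$). *)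

theory Defs
  imports
    "HOL-Analysis.Analysis"
    "HOL-Algebra.Elementary_Groups"
    "HOL-Library.Poly_Mapping"
    "HOL-Number_Theory.Cong"
    "HOL-Computational_Algebra.Polynomial_Factorial"
    "Jordan_Normal_Form.Determinant"
begin

no_notation Matrix.vec_index (infixl \<open>$\<close> 100)
hide_const (open) Determinants.det Finite_Cartesian_Product.mat

section \<open>The fundamental group\<close>

definition loops :: "'a::real_normed_vector set \<Rightarrow> 'a \<Rightarrow> (real \<Rightarrow> 'a) set" where
  "loops X b = {p. path p \<and> path_image p \<subseteq> X \<and> pathstart p = b \<and> pathfinish p = b}"

definition loop_class :: "'a::real_normed_vector set \<Rightarrow> (real \<Rightarrow> 'a) \<Rightarrow> (real \<Rightarrow> 'a) set" where
  "loop_class X p = {q. homotopic_paths X p q}"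

definition fundamental_group ::
    "'a::real_normed_vector set \<Rightarrow> 'a \<Rightarrow> (real \<Rightarrow> 'a) set monoid" where
  "fundamental_group X b =
     \<lparr>carrier = loop_class X ` loops X b,
      monoid.mult = (\<lambda>A B. {r. \<exists>p\<in>A. \<exists>q\<in>B. homotopic_paths X (p +++ q) r}),
      one = loop_class X (linepath b b)\<rparr>"

lemma loop_class_eq:
  assumes "homotopic_paths X p q"
  shows "loop_class X p = loop_class X q"
  using assms unfolding loop_class_def
  by (auto intro: homotopic_paths_trans homotopic_paths_sym)

lemma fundamental_group_mult:
  assumes "p \<in> loops X b" "q \<in> loops X b"
  shows "loop_class X p \<otimes>\<^bsub>fundamental_group X b\<^esub> loop_class X q = loop_class X (p +++ q)"
proof -
  have refl: "homotopic_paths X p p" "homotopic_paths X q q"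
    using assms by (auto simp: loops_def homotopic_paths_refl)
  have "homotopic_paths X (p +++ q) r"
    if "homotopic_paths X p p'" "homotopic_paths X q q'" "homotopic_paths X (p' +++ q') r"
    for p' q' r
  proof -
    have "homotopic_paths X (p +++ q) (p' +++ q')"
      using that assms by (intro homotopic_paths_join) (auto simp: loops_def)
    with that(3) show ?thesis by (blast intro: homotopic_paths_trans)
  qed
  then have "{r. \<exists>p'\<in>loop_class X p. \<exists>q'\<in>loop_class X q. homotopic_paths X (p' +++ q') r}
      = loop_class X (p +++ q)"
    using refl unfolding loop_class_def by blast
  then show ?thesis
    by (simp add: fundamental_group_def)
qed

lemma loops_join: "p \<in> loops X b \<Longrightarrow> q \<in> loops X b \<Longrightarrow> p +++ q \<in> loops X b"
  unfolding loops_def using path_image_join_subset by fastforce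

lemma group_fundamental_group:
  fixes X :: "'a::real_normed_vector set"
  assumes "b \<in> X"
  shows "group (fundamental_group X b)"
proof (rule groupI)
  have const: "linepath b b \<in> loops X b"
    using assms by (auto simp: loops_def)
  let ?G = "fundamental_group X b"
  have carr: "carrier ?G = loop_class X ` loops X b"
    and one: "\<one>\<^bsub>?G\<^esub> = loop_class X (linepath b b)"
    by (simp_all add: fundamental_group_def)
  show "\<one>\<^bsub>?G\<^esub> \<in> carrier ?G"
    using const by (simp add: carr one)
  show "x \<otimes>\<^bsub>?G\<^esub> y \<in> carrier ?G" if "x \<in> carrier ?G" "y \<in> carrier ?G" for x y
    using that by (auto simp: carr fundamental_group_mult loops_join)
  show "x \<otimes>\<^bsub>?G\<^esub> y \<otimes>\<^bsub>?G\<^esub> z = x \<otimes>\<^bsub>?G\<^esub> (y \<otimes>\<^bsub>?G\<^esub> z)"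
    if xyz: "x \<in> carrier ?G" "y \<in> carrier ?G" "z \<in> carrier ?G" for x y z
  proof -
    obtain p where p: "p \<in> loops X b" "x = loop_class X p"
      using xyz(1) by (auto simp: carr)
    obtain q where q: "q \<in> loops X b" "y = loop_class X q"
      using xyz(2) by (auto simp: carr)
    obtain r where r: "r \<in> loops X b" "z = loop_class X r"
      using xyz(3) by (auto simp: carr)
    have "homotopic_paths X (p +++ (q +++ r)) ((p +++ q) +++ r)"
      using p(1) q(1) r(1) by (intro homotopic_paths_assoc) (auto simp: loops_def)
    then show ?thesis
      using p q r by (simp add: fundamental_group_mult loops_join loop_class_eq)
  qed
  show "\<one>\<^bsub>?G\<^esub> \<otimes>\<^bsub>?G\<^esub> x = x" if x: "x \<in> carrier ?G" for x
  proof -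
    obtain p where p: "p \<in> loops X b" "x = loop_class X p"
      using x by (auto simp: carr)
    have "homotopic_paths X (linepath b b +++ p) p"
      using p(1) homotopic_paths_lid[of p X] by (auto simp: loops_def)
    then show ?thesis
      using p const by (simp add: one fundamental_group_mult loop_class_eq)
  qed
  show "\<exists>y\<in>carrier ?G. y \<otimes>\<^bsub>?G\<^esub> x = \<one>\<^bsub>?G\<^esub>" if x: "x \<in> carrier ?G" for x
  proof -
    obtain p where p: "p \<in> loops X b" "x = loop_class X p"
      using x by (auto simp: carr)
    have rp: "reversepath p \<in> loops X b"
      using p(1) by (auto simp: loops_def)
    have "homotopic_paths X (reversepath p +++ p) (linepath b b)"
      using p(1) homotopic_paths_linv[of p X] by (auto simp: loops_def)
    then have "loop_class X (reversepath p) \<otimes>\<^bsub>?G\<^esub> x = \<one>\<^bsub>?G\<^esub>"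
      using p rp by (simp add: one fundamental_group_mult loop_class_eq)
    then show ?thesis
      using rp by (auto simp: carr)
  qed
qed

section \<open>Oriented knots in the 3-sphere\<close>

text \<open>
  The 3-sphere is the unit sphere of \<open>\<real>\<^sup>4\<close>. An oriented knot is given by a smooth, regular,
  1-periodic parametrisation that is injective on a period; the orientation is the direction of
  increasing parameter. The functions \<open>D i\<close> are the iterated derivatives.
\<close>

abbreviation S3 :: "(real^4) set" where
  "S3 \<equiv> sphere 0 1"

definition oriented_knot :: "(real \<Rightarrow> real^4) \<Rightarrow> bool" where
  "oriented_knot \<gamma> \<longleftrightarrow>
     range \<gamma> \<subseteq> S3 \<and>
     (\<exists>D :: nat \<Rightarrow> real \<Rightarrow> real^4. D 0 = \<gamma> \<and>
        (\<forall>i x. (D i has_vector_derivative D (Suc i) x) (at x))) \<and>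
     (\<forall>x. vector_derivative \<gamma> (at x) \<noteq> 0) \<and>
     (\<forall>x. \<gamma> (x + 1) = \<gamma> x) \<and>
     inj_on \<gamma> {0..<1}"

text \<open>
  Normal vectors to the knot inside \<open>S3\<close>, and the map that pushes such a vector \<open>v\<close> (of norm
  at most 1) into \<open>S3\<close> along the great circle it spans with \<open>\<gamma> x\<close>: the image is the point
  at angle \<open>arcsin (norm v)\<close> from \<open>\<gamma> x\<close>.
\<close>

definition knot_normal :: "(real \<Rightarrow> real^4) \<Rightarrow> real \<Rightarrow> (real^4) set" where
  "knot_normal \<gamma> x = {v. v \<bullet> \<gamma> x = 0 \<and> v \<bullet> vector_derivative \<gamma> (at x) = 0}"

definition normal_push :: "(real \<Rightarrow> real^4) \<Rightarrow> real \<Rightarrow> real^4 \<Rightarrow> real^4" where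
  "normal_push \<gamma> x v = sqrt (1 - (norm v)\<^sup>2) *\<^sub>R \<gamma> x + v"

text \<open>
  The radius \<open>r\<close> is tubular if the closed disc bundle of radius \<open>r\<close> in the normal bundle is
  embedded; the image of the open disc bundle is then an open tubular neighbourhood.
\<close>

definition tubular_radius :: "(real \<Rightarrow> real^4) \<Rightarrow> real \<Rightarrow> bool" where
  "tubular_radius \<gamma> r \<longleftrightarrow> 0 < r \<and> r < 1 \<and>
     inj_on (\<lambda>(x, v). normal_push \<gamma> x v)
       {(x, v). 0 \<le> x \<and> x < 1 \<and> v \<in> knot_normal \<gamma> x \<and> norm v \<le> r}"

definition tubular_nbhd :: "(real \<Rightarrow> real^4) \<Rightarrow> real \<Rightarrow> (real^4) set" where
  "tubular_nbhd \<gamma> r = {normal_push \<gamma> x v |x v. v \<in> knot_normal \<gamma> x \<and> norm v < r}"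

definition knot_exterior :: "(real \<Rightarrow> real^4) \<Rightarrow> real \<Rightarrow> (real^4) set" where
  "knot_exterior \<gamma> r = S3 - tubular_nbhd \<gamma> r"

definition knot_group ::
    "(real \<Rightarrow> real^4) \<Rightarrow> real \<Rightarrow> real^4 \<Rightarrow> (real \<Rightarrow> real^4) set monoid" where
  "knot_group \<gamma> r b = fundamental_group (knot_exterior \<gamma> r) b"

text \<open>
  The boundary circle of the normal disc of radius \<open>r\<close> at \<open>\<gamma> x\<close>, traversed from \<open>u\<close> towards
  \<open>v\<close>. It has linking number \<open>+1\<close> with the knot if (tangent, \<open>u\<close>, \<open>v\<close>) is a positive frame of
  the 3-sphere, which is oriented as the boundary of the ball (outward normal first).
\<close>

definition meridian_circle ::
    "(real \<Rightarrow> real^4) \<Rightarrow> real \<Rightarrow> real \<Rightarrow> real^4 \<Rightarrow> real^4 \<Rightarrow> real \<Rightarrow> real^4" where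
  "meridian_circle \<gamma> r x u v s =
     normal_push \<gamma> x (r *\<^sub>R (cos (2 * pi * s) *\<^sub>R u + sin (2 * pi * s) *\<^sub>R v))"

definition positive_normal_frame ::
    "(real \<Rightarrow> real^4) \<Rightarrow> real \<Rightarrow> real^4 \<Rightarrow> real^4 \<Rightarrow> bool" where
  "positive_normal_frame \<gamma> x u v \<longleftrightarrow>
     u \<in> knot_normal \<gamma> x \<and> v \<in> knot_normal \<gamma> x \<and> norm u = 1 \<and> norm v = 1 \<and> u \<bullet> v = 0 \<and>
     Determinants.det (vector [\<gamma> x, vector_derivative \<gamma> (at x), u, v] :: real^4^4) > 0"

definition oriented_meridians ::
    "(real \<Rightarrow> real^4) \<Rightarrow> real \<Rightarrow> real^4 \<Rightarrow> (real \<Rightarrow> real^4) set set" where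
  "oriented_meridians \<gamma> r b =
     {loop_class (knot_exterior \<gamma> r) (\<alpha> +++ meridian_circle \<gamma> r x u v +++ reversepath \<alpha>) |\<alpha> x u v.
        positive_normal_frame \<gamma> x u v \<and> path \<alpha> \<and> path_image \<alpha> \<subseteq> knot_exterior \<gamma> r \<and>
        pathstart \<alpha> = b \<and> pathfinish \<alpha> = meridian_circle \<gamma> r x u v 0}"

text \<open>The abelianisation \<open>\<phi>\<close>, written additively: the exponent of \<open>t\<close>.\<close>

definition knot_abelianization ::
    "(real \<Rightarrow> real^4) \<Rightarrow> real \<Rightarrow> real^4 \<Rightarrow> ((real \<Rightarrow> real^4) set \<Rightarrow> int) \<Rightarrow> bool" where
  "knot_abelianization \<gamma> r b \<phi> \<longleftrightarrow>
     \<phi> \<in> epi (knot_group \<gamma> r b) integer_group \<and>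
     kernel (knot_group \<gamma> r b) integer_group \<phi>
       = derived (knot_group \<gamma> r b) (carrier (knot_group \<gamma> r b)) \<and>
     (\<forall>\<mu> \<in> oriented_meridians \<gamma> r b. \<phi> \<mu> = 1)"

section \<open>Free groups and Fox derivatives\<close>

text \<open>
  The free group on generators indexed by \<open>nat\<close>: words in the letters \<open>(i, True)\<close> (generator) and
  \<open>(i, False)\<close> (inverse of the generator) modulo cancellation. The group is written additively,
  although it is not commutative, so that the type \<open>free_grp \<Rightarrow>\<^sub>0 int\<close> is its integral group ring.
\<close>

fun inv_letter :: "nat \<times> bool \<Rightarrow> nat \<times> bool" where
  "inv_letter (i, s) = (i, \<not> s)"

inductive word_eq :: "(nat \<times> bool) list \<Rightarrow> (nat \<times> bool) list \<Rightarrow> bool" where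
  refl: "word_eq u u"
| sym: "word_eq u v \<Longrightarrow> word_eq v u"
| trans: "word_eq u v \<Longrightarrow> word_eq v w \<Longrightarrow> word_eq u w"
| cancel: "word_eq (u @ [x, inv_letter x] @ v) (u @ v)"

quotient_type free_grp = "(nat \<times> bool) list" / word_eq
  by (rule equivpI)
    (auto simp: reflp_def symp_def transp_def intro: word_eq.intros)

lemma inv_letter_inv_letter [simp]: "inv_letter (inv_letter x) = x"
  by (cases x) simp

lemma word_eq_append_left: "word_eq u v \<Longrightarrow> word_eq (w @ u) (w @ v)"
proof (induction rule: word_eq.induct)
  case (cancel u x v)
  show ?case using word_eq.cancel[of "w @ u" x v] by simp
qed (auto intro: word_eq.intros)

lemma word_eq_append_right: "word_eq u v \<Longrightarrow> word_eq (u @ w) (v @ w)"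
proof (induction rule: word_eq.induct)
  case (cancel u x v)
  show ?case using word_eq.cancel[of u x "v @ w"] by simp
qed (auto intro: word_eq.intros)

lemma word_eq_append: "word_eq u u' \<Longrightarrow> word_eq v v' \<Longrightarrow> word_eq (u @ v) (u' @ v')"
  by (meson word_eq.trans word_eq_append_left word_eq_append_right)

lemma word_eq_inverse:
  "word_eq u v \<Longrightarrow> word_eq (rev (map inv_letter u)) (rev (map inv_letter v))"
proof (induction rule: word_eq.induct)
  case (cancel u x v)
  show ?case
    using word_eq.cancel[of "rev (map inv_letter v)" x "rev (map inv_letter u)"] by simp
qed (auto intro: word_eq.intros)

lemma word_eq_left_inverse: "word_eq (rev (map inv_letter u) @ u) []"
proof (induction u)
  case (Cons x u)
  have "word_eq (rev (map inv_letter u) @ [inv_letter x, inv_letter (inv_letter x)] @ u)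
          (rev (map inv_letter u) @ u)"
    by (rule word_eq.cancel)
  with Cons show ?case by (auto intro: word_eq.trans)
qed (auto intro: word_eq.intros)

instantiation free_grp :: group_add
begin

lift_definition zero_free_grp :: free_grp is "[]" .

lift_definition plus_free_grp :: "free_grp \<Rightarrow> free_grp \<Rightarrow> free_grp" is append
  by (rule word_eq_append)

lift_definition uminus_free_grp :: "free_grp \<Rightarrow> free_grp" is "\<lambda>u. rev (map inv_letter u)"
  by (rule word_eq_inverse)

definition minus_free_grp :: "free_grp \<Rightarrow> free_grp \<Rightarrow> free_grp" where
  "minus_free_grp x y = x + (- y)"

instance
proof
  fix a b c :: free_grp
  show "a + b + c = a + (b + c)"
    by transfer (simp add: word_eq.refl)
  show "0 + a = a" "a + 0 = a"
    by (transfer, simp add: word_eq.refl)+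
  show "- a + a = 0"
    by transfer (rule word_eq_left_inverse)
  show "a + (- b) = a - b"
    by (simp add: minus_free_grp_def)
qed

end

lift_definition gen :: "nat \<Rightarrow> free_grp" is "\<lambda>i. [(i, True)]" .

definition free_group :: "nat \<Rightarrow> free_grp monoid" where
  "free_group m =
     \<lparr>carrier = {abs_free_grp w |w. fst ` set w \<subseteq> {..<m}}, monoid.mult = (+), one = 0\<rparr>"

text \<open>
  The Fox derivative is determined by \<open>\<partial>s\<^sub>i/\<partial>s\<^sub>j = \<delta>\<^sub>i\<^sub>j\<close> and
  \<open>\<partial>(uv)/\<partial>s\<^sub>j = \<partial>u/\<partial>s\<^sub>j + u (\<partial>v/\<partial>s\<^sub>j)\<close>, which are \<open>fox_gen\<close> and \<open>fox_add\<close> below.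
\<close>

primrec fox_word :: "nat \<Rightarrow> (nat \<times> bool) list \<Rightarrow> (free_grp \<Rightarrow>\<^sub>0 int)" where
  "fox_word j [] = 0"
| "fox_word j (x # w) =
     (if fst x \<noteq> j then 0 else if snd x then 1 else - Poly_Mapping.single (- gen j) 1) +
     Poly_Mapping.single (abs_free_grp [x]) 1 * fox_word j w"

lemma single_append:
  "Poly_Mapping.single (abs_free_grp (u @ v)) (1::int) =
     Poly_Mapping.single (abs_free_grp u) 1 * Poly_Mapping.single (abs_free_grp v) 1"
  by (simp add: mult_single plus_free_grp.abs_eq)

lemma single_Nil: "Poly_Mapping.single (abs_free_grp []) (1::int) = 1"
  by (simp flip: zero_free_grp_def)

lemma fox_word_append:
  "fox_word j (u @ v) =
     fox_word j u + Poly_Mapping.single (abs_free_grp u) 1 * fox_word j v"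
proof (induction u)
  case Nil
  then show ?case by (simp add: single_Nil)
next
  case (Cons x u)
  then show ?case
    using single_append[of "[x]" u] by (simp add: algebra_simps)
qed

lemma fox_word_cancel: "fox_word j [x, inv_letter x] = 0"
proof (cases x)
  case (Pair i s)
  have neg: "abs_free_grp [(i, False)] = - gen i" for i
    by (simp add: gen.abs_eq uminus_free_grp.abs_eq)
  have pos: "abs_free_grp [(i, True)] = gen i" for i
    by (simp add: gen.abs_eq)
  show ?thesis
    by (cases s) (auto simp: Pair neg pos mult_single)
qed

lift_definition fox :: "nat \<Rightarrow> free_grp \<Rightarrow> (free_grp \<Rightarrow>\<^sub>0 int)" is fox_word
proof -
  fix j u v
  assume "word_eq u v"
  then show "fox_word j u = fox_word j v"
  proof (induction rule: word_eq.induct)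
    case (cancel u x v)
    have "fox_word j ([x, inv_letter x] @ v) = fox_word j v"
    proof -
      have "abs_free_grp [x, inv_letter x] = abs_free_grp []"
        using word_eq.cancel[of "[]" x "[]"] by (simp add: free_grp.abs_eq_iff)
      then show ?thesis
        by (simp only: fox_word_append fox_word_cancel single_Nil) simp
    qed
    then show ?case by (simp only: fox_word_append)
  qed simp_all
qed

lemma fox_gen: "fox j (gen i) = (if i = j then 1 else 0)"
  by transfer simp

lemma fox_add: "fox j (u + v) = fox j u + Poly_Mapping.single u 1 * fox j v"
proof -
  obtain a where "u = abs_free_grp a"
    by (rule free_grp.abs_induct[of "\<lambda>u. \<exists>a. u = abs_free_grp a" u, THEN exE]) auto
  moreover obtain b where "v = abs_free_grp b"
    by (rule free_grp.abs_induct[of "\<lambda>u. \<exists>a. u = abs_free_grp a" v, THEN exE]) auto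
  ultimately show ?thesis
    by (simp add: plus_free_grp.abs_eq fox.abs_eq fox_word_append)
qed

section \<open>Wirtinger presentations\<close>

definition normal_closure :: "'g monoid \<Rightarrow> 'g set \<Rightarrow> 'g set" where
  "normal_closure G R =
     generate G {g \<otimes>\<^bsub>G\<^esub> x \<otimes>\<^bsub>G\<^esub> inv\<^bsub>G\<^esub> g |g x. g \<in> carrier G \<and> x \<in> R}"

text \<open>
  The homomorphism \<open>\<epsilon>\<close> from the free group on \<open>m\<close> generators \<open>s\<^sub>i = gen i\<close> onto \<open>G\<close> exhibits \<open>G\<close>
  as \<open>\<langle>s\<^sub>0, \<dots>, s\<^sub>m\<^sub>-\<^sub>1 | rel 0, \<dots>, rel (l - 1)\<rangle>\<close>.
\<close>

definition presentation ::
    "'g monoid \<Rightarrow> nat \<Rightarrow> nat \<Rightarrow> (free_grp \<Rightarrow> 'g) \<Rightarrow> (nat \<Rightarrow> free_grp) \<Rightarrow> bool" where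
  "presentation G m l \<epsilon> rel \<longleftrightarrow>
     \<epsilon> \<in> epi (free_group m) G \<and>
     rel ` {..<l} \<subseteq> carrier (free_group m) \<and>
     kernel (free_group m) G \<epsilon> = normal_closure (free_group m) (rel ` {..<l})"

text \<open>
  The arcs \<open>s\<^sub>0,\<dots>,s\<^sub>m\<^sub>-\<^sub>1\<close> of a diagram are numbered along the knot. At the end of \<open>s\<^sub>i\<close> the knot
  passes under an arc \<open>s\<^sub>h\<close>, which gives the relation
  \<open>s\<^sub>i\<^sub>+\<^sub>1 = s\<^sub>h s\<^sub>i s\<^sub>h\<inverse>\<close> or \<open>s\<^sub>i\<^sub>+\<^sub>1 = s\<^sub>h\<inverse> s\<^sub>i s\<^sub>h\<close> according to the sign of the crossing. The
  relation at the end of the last arc is redundant and omitted. Each generator is represented by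
  an oriented meridian.
\<close>

definition wirtinger_presentation ::
    "(real \<Rightarrow> real^4) \<Rightarrow> real \<Rightarrow> real^4 \<Rightarrow> nat \<Rightarrow>
     (free_grp \<Rightarrow> (real \<Rightarrow> real^4) set) \<Rightarrow> (nat \<Rightarrow> free_grp) \<Rightarrow> bool" where
  "wirtinger_presentation \<gamma> r b m \<epsilon> rel \<longleftrightarrow>
     m \<ge> 1 \<and>
     presentation (knot_group \<gamma> r b) m (m - 1) \<epsilon> rel \<and>
     (\<forall>i<m. \<epsilon> (gen i) \<in> oriented_meridians \<gamma> r b) \<and>
     (\<forall>i<m - 1. \<exists>h<m.
        rel i = gen h + gen i - gen h - gen (i + 1) \<or>
        rel i = - gen h + gen i + gen h - gen (i + 1))"

section \<open>Twisted Alexander polynomials over the integers\<close>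

text \<open>
  All computations take place in \<open>int poly fract\<close>, the field \<open>\<rat>(t)\<close>; the Laurent polynomial ring
  \<open>\<int>[t, t\<inverse>]\<close> is a subring of it.
\<close>

definition tvar :: "int poly fract" where
  "tvar = to_fract [:0, 1:]"

definition laurent :: "int poly fract set" where
  "laurent = {to_fract a / tvar ^ l |a l. True}"

definition laurent_dvd :: "int poly fract \<Rightarrow> int poly fract \<Rightarrow> bool" where
  "laurent_dvd x y \<longleftrightarrow> (\<exists>c\<in>laurent. y = x * c)"

text \<open>
  The additive extension of \<open>w \<mapsto> t\<^bsup>\<phi>(\<epsilon>(w))\<^esup> \<rho>(\<epsilon>(w))\<close> from the free group to its group ring;
  here \<open>\<rho>\<close> is a representation by integral \<open>k \<times> k\<close> matrices.
\<close>

definition Phi ::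
    "('g \<Rightarrow> int) \<Rightarrow> nat \<Rightarrow> ('g \<Rightarrow> int mat) \<Rightarrow> (free_grp \<Rightarrow> 'g) \<Rightarrow> (free_grp \<Rightarrow>\<^sub>0 int) \<Rightarrow>
     int poly fract mat" where
  "Phi \<phi> k \<rho> \<epsilon> z = mat k k (\<lambda>(a, c).
     \<Sum>w\<in>Poly_Mapping.keys z.
       of_int (Poly_Mapping.lookup z w) * (tvar powi \<phi> (\<epsilon> w) * of_int (\<rho> (\<epsilon> w) $$ (a, c))))"

definition fox_matrix ::
    "('g \<Rightarrow> int) \<Rightarrow> nat \<Rightarrow> ('g \<Rightarrow> int mat) \<Rightarrow> nat \<Rightarrow> (free_grp \<Rightarrow> 'g) \<Rightarrow> (nat \<Rightarrow> free_grp) \<Rightarrow>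
     int poly fract mat" where
  "fox_matrix \<phi> k \<rho> m \<epsilon> rel = mat (k * (m - 1)) (k * m) (\<lambda>(a, c).
     Phi \<phi> k \<rho> \<epsilon> (fox (c div k) (rel (a div k))) $$ (a mod k, c mod k))"

definition remove_block_col :: "nat \<Rightarrow> nat \<Rightarrow> 'a mat \<Rightarrow> 'a mat" where
  "remove_block_col k j M = mat (dim_row M) (dim_col M - k) (\<lambda>(a, c).
     M $$ (a, if c < k * j then c else c + k))"

definition fox_minor ::
    "('g \<Rightarrow> int) \<Rightarrow> nat \<Rightarrow> ('g \<Rightarrow> int mat) \<Rightarrow> nat \<Rightarrow> (free_grp \<Rightarrow> 'g) \<Rightarrow> (nat \<Rightarrow> free_grp) \<Rightarrow> nat \<Rightarrow>
     int poly fract" where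
  "fox_minor \<phi> k \<rho> m \<epsilon> rel j = det (remove_block_col k j (fox_matrix \<phi> k \<rho> m \<epsilon> rel))"

text \<open>
  The polynomials are only well defined up to units of \<open>\<int>[t, t\<inverse>]\<close>; the following predicates
  characterise their representatives. They quantify over the Wirtinger presentation and the
  removed column used in the computation.
\<close>

definition is_twisted_alexander_polynomial ::
    "(real \<Rightarrow> real^4) \<Rightarrow> real \<Rightarrow> real^4 \<Rightarrow> ((real \<Rightarrow> real^4) set \<Rightarrow> int) \<Rightarrow>
     nat \<Rightarrow> ((real \<Rightarrow> real^4) set \<Rightarrow> int mat) \<Rightarrow> int poly fract \<Rightarrow> bool" where
  "is_twisted_alexander_polynomial \<gamma> r b \<phi> k \<rho> \<tau> \<longleftrightarrow>
     (\<exists>m \<epsilon> rel j. wirtinger_presentation \<gamma> r b m \<epsilon> rel \<and> j < m \<and>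
        \<tau> = fox_minor \<phi> k \<rho> m \<epsilon> rel j / det (Phi \<phi> k \<rho> \<epsilon> (Poly_Mapping.single (gen j) 1 - 1)))"

text \<open>
  The classical Alexander polynomial is a greatest common divisor in \<open>\<int>[t, t\<inverse>]\<close> of the maximal
  minors of the untwisted Fox matrix. By multiplying with a power of \<open>t\<close> it is taken in \<open>\<int>[t]\<close>.
\<close>

definition is_alexander_polynomial ::
    "(real \<Rightarrow> real^4) \<Rightarrow> real \<Rightarrow> real^4 \<Rightarrow> ((real \<Rightarrow> real^4) set \<Rightarrow> int) \<Rightarrow> int poly \<Rightarrow> bool" where
  "is_alexander_polynomial \<gamma> r b \<phi> \<Delta> \<longleftrightarrow>
     (\<exists>m \<epsilon> rel. wirtinger_presentation \<gamma> r b m \<epsilon> rel \<and>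
        (let minor = fox_minor \<phi> 1 (\<lambda>_. 1\<^sub>m 1) m \<epsilon> rel in
          (\<forall>j<m. laurent_dvd (to_fract \<Delta>) (minor j)) \<and>
          (\<forall>d\<in>laurent. (\<forall>j<m. laurent_dvd d (minor j)) \<longrightarrow> laurent_dvd d (to_fract \<Delta>))))"

section \<open>Dihedral groups and regular representations\<close>

text \<open>The semidirect product of \<open>\<int>/N\<close> and \<open>{1, -1}\<close>, the latter acting by multiplication.\<close>

definition dihedral_group :: "nat \<Rightarrow> (int \<times> int) monoid" where
  "dihedral_group N =
     \<lparr>carrier = {0..<int N} \<times> {1, -1},
      monoid.mult = (\<lambda>(a, s) (c, s'). ((a + s * c) mod int N, s * s')),
      one = (0, 1)\<rparr>"

lemma group_dihedral_group:
  assumes "N \<ge> 1"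
  shows "group (dihedral_group N)"
proof (rule groupI)
  let ?G = "dihedral_group N"
  show "\<one>\<^bsub>?G\<^esub> \<in> carrier ?G"
    using assms by (simp add: dihedral_group_def)
  show "x \<otimes>\<^bsub>?G\<^esub> y \<in> carrier ?G" if "x \<in> carrier ?G" "y \<in> carrier ?G" for x y
    using that assms by (auto simp: dihedral_group_def)
  show "x \<otimes>\<^bsub>?G\<^esub> y \<otimes>\<^bsub>?G\<^esub> z = x \<otimes>\<^bsub>?G\<^esub> (y \<otimes>\<^bsub>?G\<^esub> z)"
    if "x \<in> carrier ?G" "y \<in> carrier ?G" "z \<in> carrier ?G" for x y z
    using that by (auto simp: dihedral_group_def mod_simps algebra_simps)
  show "\<one>\<^bsub>?G\<^esub> \<otimes>\<^bsub>?G\<^esub> x = x" if "x \<in> carrier ?G" for x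
    using that by (auto simp: dihedral_group_def)
  show "\<exists>y\<in>carrier ?G. y \<otimes>\<^bsub>?G\<^esub> x = \<one>\<^bsub>?G\<^esub>" if "x \<in> carrier ?G" for x
  proof (rule bexI)
    let ?y = "((- snd x * fst x) mod int N, snd x)"
    show "?y \<otimes>\<^bsub>?G\<^esub> x = \<one>\<^bsub>?G\<^esub>"
      using that by (auto simp: dihedral_group_def mod_simps)
    show "?y \<in> carrier ?G"
      using that assms by (auto simp: dihedral_group_def)
  qed
qed

text \<open>
  The basis of the group ring is ordered by the enumeration \<open>e\<close> of the group. Matrices act on row
  vectors, so row \<open>i\<close> of the matrix of \<open>g\<close> is the basis vector of \<open>e i \<otimes> g\<close>.
\<close>

definition regular_representation :: "'g monoid \<Rightarrow> (nat \<Rightarrow> 'g) \<Rightarrow> 'g \<Rightarrow> int mat" where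
  "regular_representation G e g = mat (order G) (order G) (\<lambda>(i, j).
     if e i \<otimes>\<^bsub>G\<^esub> g = e j then 1 else 0)"

section \<open>Congruence of rational functions modulo a prime\<close>

definition poly_cong :: "nat \<Rightarrow> int poly \<Rightarrow> int poly \<Rightarrow> bool" where
  "poly_cong p a c \<longleftrightarrow> (\<forall>i. [coeff a i = coeff c i] (mod int p))"

text \<open>
  Both sides are written as fractions whose denominators do not vanish modulo \<open>p\<close>. The last
  condition is the equation \<open>a / b = \<eta> t\<^bsup>l - k\<^esup> c / d\<close> in \<open>\<F>\<^sub>p(t)\<close> after clearing denominators, with
  a nonzero constant \<open>\<eta>\<close>.
\<close>

definition fract_cong :: "nat \<Rightarrow> int poly fract \<Rightarrow> int poly fract \<Rightarrow> bool" where
  "fract_cong p x y \<longleftrightarrow>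
     (\<exists>a b c d. x = to_fract a / to_fract b \<and> y = to_fract c / to_fract d \<and>
        \<not> poly_cong p b 0 \<and> \<not> poly_cong p d 0 \<and>
        (\<exists>\<eta> k l. \<not> int p dvd \<eta> \<and>
           poly_cong p (monom 1 k * (a * d)) (monom \<eta> l * (c * b))))"

end

(*
  Modulo p the regular representation of the dihedral group is triangularizable: the functions
  s^d * (u choose i) on the group, with d < 2 and i < p^n, form a basis in which the group acts
  triangularly, and the diagonal characters are the trivial one and the sign, each p^n times.
  Since f maps every meridian to a reflection, the sign composed with f is (-1)^phi. Hence the
  twisted determinants factor modulo p into p^n copies of the untwisted ones at t and at -t.
  The two sides of the congruence may be computed from different Wirtinger presentations. That the
  minors do not depend on the presentation, up to units, follows from the comparison of the Fox
  matrices as relation matrices of the same Alexander module.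
*)

theory Submission
  imports Defs
begin

section \<open>Additive extension of functions to group rings\<close>

text \<open>In \<open>int poly fract\<close> the prime p is invertible, so divisibility by p says
  nothing there. The determinants are therefore computed among the Laurent polynomials, taken as
  \<open>int \<Rightarrow>\<^sub>0 int\<close>, and only then sent to fractions by the injective
  \<open>laurent_eval\<close>. The triangular form exists because (p^n choose k) vanishes modulo p
  for 0 < k < p^n. This makes u choose i, for i < p^n, a well-defined function from Z/p^n to F_p,
  and Vandermonde's identity expands its translates and its reflection in such functions of degree
  at most i. A reflection has leading coefficient (-1)^i there, and s^d adds a further sign if d =
  1; so for each i exactly one value of d gives the trivial character. The change of basis has an
  integral inverse up to the factor 2, whence p is odd. The obstacle to comparing minors is that the
  Alexander matrix has one column too many. As all generators map to t, the rows of the relators sum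
  to zero, so a column can be deleted without loss; what remains is a square presentation matrix,
  and transition maps between two of these give divisibility of the determinants.\<close>

definition lin_ext :: "('a \<Rightarrow> 'b::comm_ring_1) \<Rightarrow> ('a \<Rightarrow>\<^sub>0 int) \<Rightarrow> 'b" where
  "lin_ext f z = (\<Sum>k\<in>Poly_Mapping.keys z. of_int (Poly_Mapping.lookup z k) * f k)"

lemma lin_ext_superset:
  assumes "finite S" "Poly_Mapping.keys z \<subseteq> S"
  shows "lin_ext f z = (\<Sum>k\<in>S. of_int (Poly_Mapping.lookup z k) * f k)"
  unfolding lin_ext_def using assms by (intro sum.mono_neutral_left) (auto simp: in_keys_iff)

lemma lin_ext_zero [simp]: "lin_ext f 0 = 0"
  by (simp add: lin_ext_def)

lemma lin_ext_single [simp]: "lin_ext f (Poly_Mapping.single k c) = of_int c * f k"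
  by (simp add: lin_ext_def)

lemma lin_ext_one: "f 0 = 1 \<Longrightarrow> lin_ext f 1 = 1"
  using lin_ext_single[of f 0 1] by simp

lemma lin_ext_add: "lin_ext f (x + y) = lin_ext f x + lin_ext f y"
proof -
  let ?S = "Poly_Mapping.keys x \<union> Poly_Mapping.keys y"
  have "lin_ext f (x + y) = (\<Sum>k\<in>?S. of_int (Poly_Mapping.lookup (x + y) k) * f k)"
    using Poly_Mapping.keys_add[of x y] by (intro lin_ext_superset) auto
  also have "\<dots> = lin_ext f x + lin_ext f y"
    by (simp add: lin_ext_superset[of ?S x] lin_ext_superset[of ?S y] lookup_add
        algebra_simps sum.distrib)
  finally show ?thesis .
qed

lemma lin_ext_diff: "lin_ext f (x - y) = lin_ext f x - lin_ext f y"
  using lin_ext_add[of f "x - y" y] by simp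

lemma lin_ext_sum: "lin_ext f (\<Sum>i\<in>I. x i) = (\<Sum>i\<in>I. lin_ext f (x i))"
  by (induction I rule: infinite_finite_induct) (auto simp: lin_ext_add)

lemma lin_ext_cong:
  "(\<And>k. k \<in> Poly_Mapping.keys z \<Longrightarrow> f k = g k) \<Longrightarrow> lin_ext f z = lin_ext g z"
  by (simp add: lin_ext_def)

lemma lin_ext_mult_right: "lin_ext f z * c = lin_ext (\<lambda>k. f k * c) z"
  by (simp add: lin_ext_def sum_distrib_right mult.assoc)

lemma lin_ext_sum_fun: "(\<Sum>i\<in>I. lin_ext (f i) z) = lin_ext (\<lambda>k. \<Sum>i\<in>I. f i k) z"
  unfolding lin_ext_def by (subst sum.swap) (simp add: sum_distrib_left)

lemma lin_ext_dvd_diff: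
  assumes "\<And>k. k \<in> Poly_Mapping.keys z \<Longrightarrow> d dvd f k - g k"
  shows "d dvd lin_ext f z - lin_ext g z"
proof -
  have "lin_ext f z - lin_ext g z =
      (\<Sum>k\<in>Poly_Mapping.keys z. of_int (Poly_Mapping.lookup z k) * (f k - g k))"
    by (simp add: lin_ext_def sum_subtractf algebra_simps)
  with assms show ?thesis by (auto intro!: dvd_sum)
qed

lemma poly_mapping_sum_single:
  "z = (\<Sum>k\<in>Poly_Mapping.keys z. Poly_Mapping.single k (Poly_Mapping.lookup z k))"
  by (rule poly_mapping_eqI)
    (simp add: lookup_sum lookup_single when_def in_keys_iff)

text \<open>Multiplicativity of \<open>f\<close> is asked for on the supports only:
  \<open>monomial\<close> is known to be multiplicative just on words in the first \<open>m\<close>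
  generators, where \<open>\<epsilon>\<close> is a homomorphism.\<close>

lemma lin_ext_mult:
  assumes "\<And>k l. k \<in> Poly_Mapping.keys x \<Longrightarrow> l \<in> Poly_Mapping.keys y \<Longrightarrow> f (k + l) = f k * f l"
  shows "lin_ext f (x * y) = lin_ext f x * lin_ext f y"
proof -
  have "x * y = (\<Sum>k\<in>Poly_Mapping.keys x. \<Sum>l\<in>Poly_Mapping.keys y.
      Poly_Mapping.single (k + l) (Poly_Mapping.lookup x k * Poly_Mapping.lookup y l))"
    by (subst (1) poly_mapping_sum_single[of x], subst (1) poly_mapping_sum_single[of y])
      (simp add: sum_product mult_single)
  then have "lin_ext f (x * y) = (\<Sum>k\<in>Poly_Mapping.keys x. \<Sum>l\<in>Poly_Mapping.keys y.
      of_int (Poly_Mapping.lookup x k) * of_int (Poly_Mapping.lookup y l) * (f k * f l))"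
    using assms by (simp add: lin_ext_sum)
  then show ?thesis
    by (simp add: lin_ext_def sum_product algebra_simps)
qed

lemma (in comm_ring_hom) hom_lin_ext: "hom (lin_ext f z) = lin_ext (\<lambda>k. hom (f k)) z"
  by (simp add: lin_ext_def hom_distribs)

lemma comm_ring_hom_lin_ext:
  assumes "f 0 = 1" "\<And>k l. f (k + l) = f k * f l"
  shows "comm_ring_hom (lin_ext f :: ('a::comm_monoid_add \<Rightarrow>\<^sub>0 int) \<Rightarrow> 'b::comm_ring_1)"
  by standard (auto simp: assms lin_ext_one lin_ext_add intro!: lin_ext_mult)

section \<open>Determinants\<close>

lemma dvd_prod_diff:
  fixes d :: "'b::comm_ring_1"
  assumes "\<And>i. i \<in> I \<Longrightarrow> d dvd f i - g i"
  shows "d dvd prod f I - prod g I"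
  using assms
proof (induction I rule: infinite_finite_induct)
  case (insert i I)
  have "prod f (insert i I) - prod g (insert i I)
      = (f i - g i) * prod f I + g i * (prod f I - prod g I)"
    using insert by (simp add: algebra_simps)
  with insert show ?case by simp
qed auto

text \<open>By the Leibniz formula the determinant is an integral polynomial in the entries, so it
  respects congruences.\<close>

lemma det_dvd_diff:
  fixes d :: "'b::comm_ring_1"
  assumes "A \<in> carrier_mat n n" "B \<in> carrier_mat n n"
    and "\<And>i j. i < n \<Longrightarrow> j < n \<Longrightarrow> d dvd A $$ (i, j) - B $$ (i, j)"
  shows "d dvd det A - det B"
proof -
  have "d dvd (\<Prod>i=0..<n. A $$ (i, q i)) - (\<Prod>i=0..<n. B $$ (i, q i))"
    if "q permutes {0..<n}" for q
    using that assms(3) permutes_in_image[OF that] by (intro dvd_prod_diff) auto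
  then show ?thesis
    using assms(1,2)
    by (auto simp: det_def' sum_subtractf[symmetric] right_diff_distrib[symmetric] intro!: dvd_sum)
qed

lemma mult_mat_index:
  assumes "A \<in> carrier_mat l m" "B \<in> carrier_mat m n" "i < l" "j < n"
  shows "(A * B) $$ (i, j) = (\<Sum>k<m. A $$ (i, k) * B $$ (k, j))"
  using assms by (auto simp: scalar_prod_def lessThan_atLeast0)

text \<open>
  Both \<open>[J2 0; -B 1]\<close> and \<open>[1 -A; 0 J1]\<close> present the same module, with generators the union of
  the two generating sets.
\<close>

lemma det_dvd_of_common_module:
  fixes J1 J2 :: "'a::idom mat"
  assumes J1: "J1 \<in> carrier_mat a a" and J2: "J2 \<in> carrier_mat b b"
    and A: "A \<in> carrier_mat b a" and B: "B \<in> carrier_mat a b"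
    and X: "X \<in> carrier_mat b a" and W: "W \<in> carrier_mat a a"
    and 1: "J2 * A = X * J1" and 2: "B * A = 1\<^sub>m a + W * J1"
  shows "det J1 dvd det J2"
proof -
  \<comment> \<open>The rows of the first of the two presentation matrices have to be combinations
    of the rows of \<open>?V\<close>, the second one. \<open>?U\<close> collects the coefficients,
    which are read off from the equations 1 and 2.\<close>
  let ?U = "four_block_mat J2 X (- B) (- W)"
  let ?V = "four_block_mat (1\<^sub>m b) (- A) (0\<^sub>m a b) J1"
  have "?U * ?V = four_block_mat (J2 * 1\<^sub>m b + X * 0\<^sub>m a b) (J2 * - A + X * J1)
      ((- B) * 1\<^sub>m b + (- W) * 0\<^sub>m a b) ((- B) * (- A) + (- W) * J1)"
    using assms by (intro mult_four_block_mat) auto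
  also have "J2 * 1\<^sub>m b + X * 0\<^sub>m a b = J2"
    using J2 X by auto
  also have "J2 * - A + X * J1 = 0\<^sub>m b a"
    using J1 X J2 A by (simp add: 1[symmetric])
  also have "(- B) * 1\<^sub>m b + (- W) * 0\<^sub>m a b = - B"
    using B W by auto
  also have "(- B) * (- A) + (- W) * J1 = 1\<^sub>m a"
  proof -
    have "(- B) * (- A) + (- W) * J1 = B * A + - (W * J1)"
      using assms by simp
    also have "\<dots> = 1\<^sub>m a"
      unfolding 2 using W J1 by (intro eq_matI) auto
    finally show ?thesis .
  qed
  finally have UV: "?U * ?V = four_block_mat J2 (0\<^sub>m b a) (- B) (1\<^sub>m a)" .
  have "det J2 = det (?U * ?V)"
    unfolding UV using J2 B by (subst det_four_block_mat_upper_right_zero[of _ b _ a]) auto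
  also have "\<dots> = det ?U * det ?V"
    using assms by (intro det_mult[of _ "b + a"]) auto
  also have "det ?V = det J1"
    using J1 A by (subst det_four_block_mat_lower_left_zero[of _ b _ a]) auto
  finally show ?thesis by simp
qed

lemma det_block_triangular:
  fixes A :: "'a::idom mat"
  assumes "A \<in> carrier_mat (k * q) (k * q)"
    and "\<And>a c. a < k * q \<Longrightarrow> c < k * q \<Longrightarrow> c div q < a div q \<Longrightarrow> A $$ (a, c) = 0"
  shows "det A = (\<Prod>i<k. det (mat q q (\<lambda>(r, c). A $$ (i * q + r, i * q + c))))"
  using assms
proof (induction k arbitrary: A)
  case (Suc k)
  let ?n = "k * q"
  let ?A1 = "mat ?n ?n (\<lambda>(a, c). A $$ (a, c))"
  let ?A2 = "mat ?n q (\<lambda>(a, c). A $$ (a, ?n + c))"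
  let ?A4 = "mat q q (\<lambda>(a, c). A $$ (?n + a, ?n + c))"
  have zero: "A $$ (?n + a, c) = 0" if "a < q" "c < ?n" for a c
  proof (rule Suc.prems(2))
    have "c div q < k"
      using that by (simp add: less_mult_imp_div_less)
    then show "c div q < (?n + a) div q"
      using that(1) by simp
  qed (use that in auto)
  have split: "A = four_block_mat ?A1 ?A2 (0\<^sub>m q ?n) ?A4"
  proof (rule eq_matI)
    fix i j assume "i < dim_row (four_block_mat ?A1 ?A2 (0\<^sub>m q ?n) ?A4)"
      "j < dim_col (four_block_mat ?A1 ?A2 (0\<^sub>m q ?n) ?A4)"
    then have "i < ?n + q" "j < ?n + q" by simp_all
    then show "A $$ (i, j) = four_block_mat ?A1 ?A2 (0\<^sub>m q ?n) ?A4 $$ (i, j)"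
      using zero[of "i - ?n" j] by (auto simp: not_less)
  qed (use Suc.prems in \<open>auto simp: add.commute\<close>)
  have "det A = det ?A1 * det ?A4"
    by (subst split, rule det_four_block_mat_lower_left_zero) auto
  also have "det ?A1 = (\<Prod>i<k. det (mat q q (\<lambda>(r, c). ?A1 $$ (i * q + r, i * q + c))))"
    using Suc.prems(2) by (intro Suc.IH) auto
  also have "\<dots> = (\<Prod>i<k. det (mat q q (\<lambda>(r, c). A $$ (i * q + r, i * q + c))))"
  proof (rule prod.cong[OF HOL.refl])
    fix i assume "i \<in> {..<k}"
    then have "i * q + r < k * q" if "r < q" for r
      using mult_le_mono1[of "Suc i" k q] that by auto
    then show "det (mat q q (\<lambda>(r, c). ?A1 $$ (i * q + r, i * q + c)))
        = det (mat q q (\<lambda>(r, c). A $$ (i * q + r, i * q + c)))"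
      by (intro arg_cong[of _ _ det] eq_matI) auto
  qed
  finally show ?case by simp
qed auto

text \<open>An index \<open>r * k + i\<close> consists of a block position \<open>r\<close> and an
  inner position \<open>i\<close>, and the matrix is triangular in the inner one. Renumbering rows
  and columns alike so that \<open>i\<close> becomes the block position reduces this to
  \<open>det_block_triangular\<close>.\<close>

lemma det_block_upper_triangular:
  fixes A :: "'a::idom mat"
  assumes A: "A \<in> carrier_mat (k * q) (k * q)"
    and zero: "\<And>a c. a < k * q \<Longrightarrow> c < k * q \<Longrightarrow> c mod k < a mod k \<Longrightarrow> A $$ (a, c) = 0"
  shows "det A = (\<Prod>i<k. det (mat q q (\<lambda>(r, c). A $$ (r * k + i, c * k + i))))"
proof -
  let ?n = "k * q"
  \<comment> \<open>\<open>\<sigma>\<close> sends \<open>i * q + r\<close> to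
    \<open>r * k + i\<close>, the transposition of a rectangular grid; it is the identity outside so
    as to be a permutation in the sense of \<open>permutes\<close>.\<close>
  define \<sigma> where "\<sigma> a = (if a < ?n then (a mod q) * k + a div q else a)" for a
  have \<sigma>_lt: "\<sigma> a < ?n" and \<sigma>_mod: "\<sigma> a mod k = a div q" and \<sigma>_div: "\<sigma> a div k = a mod q"
    if "a < ?n" for a
  proof -
    have d: "a div q < k" and q: "0 < q"
      using that by (simp_all add: less_mult_imp_div_less) (metis gr0I mult_0_right not_less_zero)
    have "a mod q * k + a div q < Suc (a mod q) * k"
      using d by simp
    also have "\<dots> \<le> ?n"
      using q by (metis Suc_leI mod_less_divisor mult.commute mult_le_mono1)
    finally show "\<sigma> a < ?n"
      using that by (simp add: \<sigma>_def)
    show "\<sigma> a mod k = a div q" "\<sigma> a div k = a mod q"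
      using that d by (simp_all add: \<sigma>_def)
  qed
  have perm: "\<sigma> permutes {0..<?n}"
  proof (rule bij_imp_permutes)
    have inj: "inj_on \<sigma> {0..<?n}"
      by (rule inj_onI) (metis \<sigma>_mod \<sigma>_div atLeastLessThan_iff div_mult_mod_eq)
    moreover have "\<sigma> ` {0..<?n} \<subseteq> {0..<?n}"
      using \<sigma>_lt by auto
    ultimately show "bij_betw \<sigma> {0..<?n} {0..<?n}"
      by (simp add: bij_betw_def endo_inj_surj)
  qed (simp add: \<sigma>_def)
  let ?B = "mat ?n ?n (\<lambda>(a, c). A $$ (\<sigma> a, c))"
  let ?C = "mat ?n ?n (\<lambda>(a, c). ?B $$ (a, \<sigma> c))"
  have C: "?C = mat ?n ?n (\<lambda>(a, c). A $$ (\<sigma> a, \<sigma> c))"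
    using \<sigma>_lt by (intro eq_matI) auto
  \<comment> \<open>The columns are permuted by way of the transpose. The sign of
    \<open>\<sigma>\<close> enters once for rows and once for columns and cancels.\<close>
  have "det ?C = det ?C\<^sup>T"
    by (rule det_transpose[symmetric, of _ ?n]) simp
  also have "?C\<^sup>T = mat ?n ?n (\<lambda>(a, c). ?B\<^sup>T $$ (\<sigma> a, c))"
    using \<sigma>_lt by (intro eq_matI) auto
  also have "det \<dots> = signof \<sigma> * det ?B\<^sup>T"
    by (rule det_permute_rows[OF _ perm]) simp
  also have "det ?B\<^sup>T = det ?B"
    by (rule det_transpose[of _ ?n]) simp
  also have "\<dots> = signof \<sigma> * det A"
    by (rule det_permute_rows[OF A perm])
  finally have "det A = det ?C"
    by (simp add: sign_def)
  also have "\<dots> = (\<Prod>i<k. det (mat q q (\<lambda>(r, c). ?C $$ (i * q + r, i * q + c))))"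
    using zero \<sigma>_lt \<sigma>_mod unfolding C by (intro det_block_triangular) auto
  also have "\<dots> = (\<Prod>i<k. det (mat q q (\<lambda>(r, c). A $$ (r * k + i, c * k + i))))"
  proof (rule prod.cong[OF HOL.refl])
    fix i assume "i \<in> {..<k}"
    then have lt: "i * q + r < k * q" if "r < q" for r
      using mult_le_mono1[of "Suc i" k q] that by auto
    moreover have "\<sigma> (i * q + r) = r * k + i" if "r < q" for r
      using that lt[OF that] by (simp add: \<sigma>_def)
    ultimately show "det (mat q q (\<lambda>(r, c). ?C $$ (i * q + r, i * q + c)))
        = det (mat q q (\<lambda>(r, c). A $$ (r * k + i, c * k + i)))"
      unfolding C by (intro arg_cong[of _ _ det] eq_matI) auto
  qed
  finally show ?thesis .
qed

section \<open>Free groups and Fox derivatives\<close>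

lemma zero_free_group [simp]: "0 \<in> carrier (free_group m)"
  by (auto simp: free_group_def zero_free_grp_def intro!: exI[of _ "[]"])

lemma add_free_group [simp]:
  "u \<in> carrier (free_group m) \<Longrightarrow> v \<in> carrier (free_group m) \<Longrightarrow> u + v \<in> carrier (free_group m)"
  by (auto simp: free_group_def plus_free_grp.abs_eq) (metis Un_subset_iff image_Un set_append)

lemma uminus_free_group [simp]:
  assumes "u \<in> carrier (free_group m)"
  shows "- u \<in> carrier (free_group m)"
proof -
  obtain w where w: "u = abs_free_grp w" "fst ` set w \<subseteq> {..<m}"
    using assms by (auto simp: free_group_def)
  have "fst (inv_letter x) = fst x" for x
    by (cases x) simp
  then have "fst ` set (rev (map inv_letter w)) \<subseteq> {..<m}"
    using w(2) by auto
  then show ?thesis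
    unfolding w(1) uminus_free_grp.abs_eq free_group_def partial_object.simps by blast
qed

lemma gen_free_group [simp]: "i < m \<Longrightarrow> gen i \<in> carrier (free_group m)"
  by (auto simp: free_group_def gen.abs_eq intro!: exI[of _ "[(i, True)]"])

lemma free_group_simps [simp]:
  "x \<otimes>\<^bsub>free_group m\<^esub> y = x + y" "\<one>\<^bsub>free_group m\<^esub> = 0"
  by (simp_all add: free_group_def)

lemma group_free_group: "group (free_group m)"
  by (rule groupI) (auto simp: add.assoc intro: uminus_free_group left_minus)

lemma inv_free_group [simp]:
  "u \<in> carrier (free_group m) \<Longrightarrow> inv\<^bsub>free_group m\<^esub> u = - u"
  by (rule group.inv_equality[OF group_free_group]) auto

lemma abs_free_grp_Cons: "abs_free_grp (x # w) = abs_free_grp [x] + abs_free_grp w"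
  by (simp add: plus_free_grp.abs_eq)

lemma abs_free_grp_letter: "abs_free_grp [(i, s)] = (if s then gen i else - gen i)"
  by (simp add: gen.abs_eq uminus_free_grp.abs_eq)

text \<open>Letters are split off on the left, as the product rule \<open>fox_add\<close>
  requires.\<close>

lemma free_group_induct [consumes 1, case_names zero gen inv]:
  assumes "w \<in> carrier (free_group m)"
    and "P 0"
    and "\<And>i w. i < m \<Longrightarrow> w \<in> carrier (free_group m) \<Longrightarrow> P w \<Longrightarrow> P (gen i + w)"
    and "\<And>i w. i < m \<Longrightarrow> w \<in> carrier (free_group m) \<Longrightarrow> P w \<Longrightarrow> P (- gen i + w)"
  shows "P w"
proof -
  obtain u where u: "w = abs_free_grp u" "fst ` set u \<subseteq> {..<m}"
    using assms(1) by (auto simp: free_group_def)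
  have "P (abs_free_grp u)"
    using u(2)
  proof (induction u)
    case (Cons x u)
    then have "abs_free_grp u \<in> carrier (free_group m)"
      by (auto simp: free_group_def)
    moreover obtain i s where "x = (i, s)"
      by (cases x)
    ultimately show ?case
      using Cons assms(3,4) by (simp add: abs_free_grp_Cons[of "(i, s)" u] abs_free_grp_letter)
  qed (use assms(2) in \<open>simp add: zero_free_grp_def\<close>)
  then show ?thesis using u by simp
qed

lemma fox_zero [simp]: "fox j 0 = 0"
  using fox_add[of j 0 0] by simp

lemma fox_uminus: "fox j (- u) = - (Poly_Mapping.single (- u) 1 * fox j u)"
  using fox_add[of j "- u" u] by (simp add: eq_neg_iff_add_eq_0)

lemma keys_single_mult_subset:
  "Poly_Mapping.keys (Poly_Mapping.single u 1 * (x :: 'a::monoid_add \<Rightarrow>\<^sub>0 int))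
     \<subseteq> (\<lambda>v. u + v) ` Poly_Mapping.keys x"
  using keys_mult[of "Poly_Mapping.single u 1" x] by auto

text \<open>The type \<open>free_grp\<close> has infinitely many generators, whereas
  \<open>\<epsilon>\<close> is a homomorphism only on the words in the first \<open>m\<close>. The
  derivatives must not leave this range.\<close>

lemma keys_fox:
  assumes "w \<in> carrier (free_group m)"
  shows "Poly_Mapping.keys (fox j w) \<subseteq> carrier (free_group m)"
  using assms
proof (induction rule: free_group_induct)
  case (gen i w)
  then have "Poly_Mapping.keys (Poly_Mapping.single (gen i) 1 * fox j w) \<subseteq> carrier (free_group m)"
    by (intro order.trans[OF keys_single_mult_subset]) auto
  then show ?case
    using Poly_Mapping.keys_add[of "fox j (gen i)" "Poly_Mapping.single (gen i) 1 * fox j w"]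
    by (auto simp: fox_add fox_gen split: if_splits)
next
  case (inv i w)
  have "Poly_Mapping.keys (fox j (- gen i)) \<subseteq> carrier (free_group m)"
    using inv(1) by (auto simp: fox_uminus fox_gen)
  moreover have "Poly_Mapping.keys (Poly_Mapping.single (- gen i) 1 * fox j w) \<subseteq> carrier (free_group m)"
    using inv by (intro order.trans[OF keys_single_mult_subset]) auto
  ultimately show ?case
    using Poly_Mapping.keys_add[of "fox j (- gen i)" "Poly_Mapping.single (- gen i) 1 * fox j w"]
    by (auto simp: fox_add)
qed simp

section \<open>Independence of the presentation\<close>

text \<open>The increasing enumeration of the columns that survive the deletion of column
  \<open>j\<close>.\<close>

definition skip :: "nat \<Rightarrow> nat \<Rightarrow> nat" where
  "skip j k = (if k < j then k else Suc k)"

lemma sum_skip: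
  fixes g :: "nat \<Rightarrow> 'a::ab_group_add"
  assumes "j < m"
  shows "(\<Sum>k<m - 1. g (skip j k)) = (\<Sum>k<m. g k) - g j"
proof -
  have "bij_betw (skip j) {..<m - 1} ({..<m} - {j})"
    using assms by (intro bij_betw_byWitness[where f' = "\<lambda>k. if k < j then k else k - 1"])
      (auto simp: skip_def)
  then have "(\<Sum>k<m - 1. g (skip j k)) = (\<Sum>k\<in>{..<m} - {j}. g k)"
    by (rule sum.reindex_bij_betw)
  also have "\<dots> = (\<Sum>k<m. g k) - g j"
    using assms by (simp add: sum_diff1)
  finally show ?thesis .
qed

text \<open>The ring of Laurent polynomials is represented by the group ring \<open>int \<Rightarrow>\<^sub>0 int\<close> of the integers.\<close>

abbreviation laurent_var :: "int \<Rightarrow>\<^sub>0 int" where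
  "laurent_var \<equiv> Poly_Mapping.single 1 1"

text \<open>The part of a Wirtinger presentation on which the Fox calculus depends: one relator
  fewer than generators, and generators of exponent 1. The conjugation form of the relators enters
  later, as a separate hypothesis of \<open>dihedral_sign\<close>.\<close>

locale meridional_presentation =
  fixes G :: "'g monoid" and \<phi> :: "'g \<Rightarrow> int" and m :: nat
    and \<epsilon> :: "free_grp \<Rightarrow> 'g" and rel :: "nat \<Rightarrow> free_grp"
  assumes group_G: "group G"
    and hom_phi: "\<phi> \<in> hom G integer_group"
    and m_pos: "m \<ge> 1"
    and pres: "presentation G m (m - 1) \<epsilon> rel"
    and phi_gen: "\<And>i. i < m \<Longrightarrow> \<phi> (\<epsilon> (gen i)) = 1"
begin

interpretation G: group G
  by (rule group_G)

abbreviation "F \<equiv> carrier (free_group m)"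

lemma eps_hom: "\<epsilon> \<in> hom (free_group m) G"
  using pres by (simp add: presentation_def epi_def)

lemma eps_closed [simp]: "u \<in> F \<Longrightarrow> \<epsilon> u \<in> carrier G"
  using eps_hom by (auto simp: hom_def)

lemma eps_add [simp]: "u \<in> F \<Longrightarrow> v \<in> F \<Longrightarrow> \<epsilon> (u + v) = \<epsilon> u \<otimes>\<^bsub>G\<^esub> \<epsilon> v"
  using hom_mult[OF eps_hom] by simp

lemma group_hom_eps: "group_hom (free_group m) G \<epsilon>"
  by (intro group_hom.intro group_hom_axioms.intro group_free_group group_G eps_hom)

lemma eps_zero [simp]: "\<epsilon> 0 = \<one>\<^bsub>G\<^esub>"
  using group_hom.hom_one[OF group_hom_eps] by simp

lemma eps_uminus [simp]: "u \<in> F \<Longrightarrow> \<epsilon> (- u) = inv\<^bsub>G\<^esub> \<epsilon> u"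
  using group_hom.hom_inv[OF group_hom_eps, of u] by simp

lemma eps_image: "\<epsilon> ` F = carrier G"
  using pres by (simp add: presentation_def epi_def)

lemma eps_surj: "g \<in> carrier G \<Longrightarrow> \<exists>w\<in>F. \<epsilon> w = g"
  unfolding eps_image[symmetric] by auto

lemma rel_F: "i < m - 1 \<Longrightarrow> rel i \<in> F"
  using pres by (auto simp: presentation_def)

lemma phi_mult [simp]:
  "x \<in> carrier G \<Longrightarrow> y \<in> carrier G \<Longrightarrow> \<phi> (x \<otimes>\<^bsub>G\<^esub> y) = \<phi> x + \<phi> y"
  using hom_mult[OF hom_phi] by simp

lemma phi_one [simp]: "\<phi> \<one>\<^bsub>G\<^esub> = 0"
  using phi_mult[of "\<one>\<^bsub>G\<^esub>" "\<one>\<^bsub>G\<^esub>"] by simp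

lemma conjugates_eq:
  "{g \<otimes>\<^bsub>free_group m\<^esub> x \<otimes>\<^bsub>free_group m\<^esub> inv\<^bsub>free_group m\<^esub> g |g x. g \<in> F \<and> x \<in> R}
     = {g + x - g |g x. g \<in> F \<and> x \<in> R}"
  by (intro Collect_cong ex_cong1) auto

lemma kernel_eq:
  "kernel (free_group m) G \<epsilon> = generate (free_group m) {g + x - g |g x. g \<in> F \<and> x \<in> rel ` {..<m - 1}}"
  using pres unfolding presentation_def normal_closure_def conjugates_eq by simp

lemma kernel_closure:
  assumes "w \<in> generate (free_group m) H" "H \<subseteq> kernel (free_group m) G \<epsilon>"
  shows "w \<in> F \<and> \<epsilon> w = \<one>\<^bsub>G\<^esub>"
proof -
  have "w \<in> kernel (free_group m) G \<epsilon>"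
    using group.generate_subgroup_incl[OF group_free_group assms(2) group_hom.subgroup_kernel[OF group_hom_eps]] assms(1)
    by blast
  then show ?thesis by (simp add: kernel_def)
qed

lemma eps_rel: "i < m - 1 \<Longrightarrow> \<epsilon> (rel i) = \<one>\<^bsub>G\<^esub>"
proof -
  assume i: "i < m - 1"
  have "rel i = 0 + rel i - 0" by simp
  then have "rel i \<in> {g + x - g |g x. g \<in> F \<and> x \<in> rel ` {..<m - 1}}"
    using i by (blast intro: zero_free_group)
  then have "rel i \<in> kernel (free_group m) G \<epsilon>"
    unfolding kernel_eq by (rule generate.incl)
  then show ?thesis by (simp add: kernel_def)
qed

section \<open>Abelianized Fox derivatives\<close>

definition monomial :: "free_grp \<Rightarrow> int \<Rightarrow>\<^sub>0 int" where
  "monomial w = Poly_Mapping.single (\<phi> (\<epsilon> w)) 1"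

text \<open>The entries \<open>alex k (rel i)\<close> form the Alexander matrix. As a function of
  \<open>w\<close> this is a crossed homomorphism, by \<open>alex_add\<close>.\<close>

definition alex :: "nat \<Rightarrow> free_grp \<Rightarrow> int \<Rightarrow>\<^sub>0 int" where
  "alex j w = lin_ext monomial (fox j w)"

lemma monomial_add: "u \<in> F \<Longrightarrow> v \<in> F \<Longrightarrow> monomial (u + v) = monomial u * monomial v"
  by (simp add: monomial_def mult_single)

lemma monomial_zero [simp]: "monomial 0 = 1"
  by (simp add: monomial_def)

lemma monomial_gen: "i < m \<Longrightarrow> monomial (gen i) = laurent_var"
  by (simp add: monomial_def phi_gen)

lemma monomial_uminus: "u \<in> F \<Longrightarrow> monomial u * monomial (- u) = 1"
  using monomial_add[of u "- u"] by simp

lemma alex_gen: "alex j (gen i) = (if i = j then 1 else 0)"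
  using lin_ext_one[of monomial] by (simp add: alex_def fox_gen)

lemma alex_zero [simp]: "alex j 0 = 0"
  by (simp add: alex_def)

lemma alex_add:
  assumes "u \<in> F" "v \<in> F"
  shows "alex j (u + v) = alex j u + monomial u * alex j v"
proof -
  have "lin_ext monomial (Poly_Mapping.single u 1 * fox j v) = monomial u * alex j v"
    using keys_fox[OF assms(2), of j] assms(1) unfolding alex_def
    by (subst lin_ext_mult) (auto intro!: monomial_add)
  then show ?thesis by (simp add: alex_def fox_add lin_ext_add)
qed

lemma alex_uminus: "u \<in> F \<Longrightarrow> alex j (- u) = - (monomial (- u) * alex j u)"
  using alex_add[of "- u" u j] by (simp add: eq_neg_iff_add_eq_0)

text \<open>The fundamental formula of Fox calculus, w - 1 = sum of (dw/ds_j) (s_j - 1), in which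
  every factor s_j - 1 becomes t - 1.\<close>

lemma alex_row_sum:
  assumes "w \<in> F"
  shows "(laurent_var - 1) * (\<Sum>j<m. alex j w) = monomial w - 1"
  using assms
proof (induction rule: free_group_induct)
  case (gen i w)
  have "(\<Sum>j<m. alex j (gen i + w)) = 1 + laurent_var * (\<Sum>j<m. alex j w)"
    using gen by (simp add: alex_add alex_gen monomial_gen sum.distrib sum_distrib_left)
  then show ?case
    using gen by (simp add: monomial_add monomial_gen algebra_simps)
next
  case (inv i w)
  let ?u = "monomial (- gen i)"
  have u: "laurent_var * ?u = 1"
    using monomial_uminus[of "gen i"] monomial_gen[of i] inv(1) by simp
  have "(\<Sum>j<m. alex j (- gen i + w)) = - ?u + ?u * (\<Sum>j<m. alex j w)"
    using inv by (simp add: alex_add alex_uminus alex_gen sum.distrib sum_distrib_left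
        sum_subtractf if_distrib[of "\<lambda>x. _ * x"] cong: if_cong)
  then have "(laurent_var - 1) * (\<Sum>j<m. alex j (- gen i + w))
      = (laurent_var - 1) * (- ?u + ?u * (\<Sum>j<m. alex j w))"
    by (rule arg_cong)
  also have "\<dots> = ?u * ((laurent_var - 1) * (\<Sum>j<m. alex j w)) - laurent_var * ?u + ?u"
    by (simp add: algebra_simps)
  also have "\<dots> = ?u * monomial w - 1"
    unfolding inv u by (simp add: algebra_simps)
  finally show ?case
    using inv by (simp add: monomial_add)
qed simp

lemma laurent_var_neq_one: "laurent_var - 1 \<noteq> 0"
proof
  assume "laurent_var - 1 = 0"
  then have "Poly_Mapping.lookup laurent_var 1 = Poly_Mapping.lookup (1 :: int \<Rightarrow>\<^sub>0 int) 1"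
    by simp
  then show False by (simp add: lookup_one)
qed

text \<open>Applied to relators, this makes each column of the Alexander matrix minus the sum of the
  others.\<close>

lemma alex_row_sum_zero:
  assumes "w \<in> F" "\<phi> (\<epsilon> w) = 0"
  shows "(\<Sum>j<m. alex j w) = 0"
  using alex_row_sum[OF assms(1)] assms(2) laurent_var_neq_one by (simp add: monomial_def)

lemma alex_row_sum_one:
  assumes "w \<in> F" "\<phi> (\<epsilon> w) = 1"
  shows "(\<Sum>j<m. alex j w) = 1"
proof -
  have "(laurent_var - 1) * (\<Sum>j<m. alex j w) = (laurent_var - 1) * 1"
    using alex_row_sum[OF assms(1)] assms(2) by (simp add: monomial_def)
  then show ?thesis
    using laurent_var_neq_one mult_left_cancel by blast
qed

text \<open>The relation submodule of the Alexander module. Only coordinates below \<open>m\<close>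
  are constrained, so functions need not be cut off there.\<close>

definition row_space :: "(nat \<Rightarrow> int \<Rightarrow>\<^sub>0 int) set" where
  "row_space = {v. \<exists>x. \<forall>k<m. v k = (\<Sum>i<m - 1. x i * alex k (rel i))}"

lemma row_space_zero [simp]: "(\<lambda>_. 0) \<in> row_space"
  by (auto simp: row_space_def intro!: exI[of _ "\<lambda>_. 0"])

lemma row_space_add:
  assumes "u \<in> row_space" "v \<in> row_space"
  shows "(\<lambda>k. u k + v k) \<in> row_space"
proof -
  obtain x y where "\<forall>k<m. u k = (\<Sum>i<m - 1. x i * alex k (rel i))"
    "\<forall>k<m. v k = (\<Sum>i<m - 1. y i * alex k (rel i))"
    using assms by (auto simp: row_space_def)
  then show ?thesis
    by (auto simp: row_space_def algebra_simps sum.distrib intro!: exI[of _ "\<lambda>i. x i + y i"])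
qed

lemma row_space_mult:
  assumes "u \<in> row_space"
  shows "(\<lambda>k. c * u k) \<in> row_space"
proof -
  obtain x where "\<forall>k<m. u k = (\<Sum>i<m - 1. x i * alex k (rel i))"
    using assms by (auto simp: row_space_def)
  then show ?thesis
    by (auto simp: row_space_def sum_distrib_left mult.assoc intro!: exI[of _ "\<lambda>i. c * x i"])
qed

lemma row_space_rel: "i < m - 1 \<Longrightarrow> (\<lambda>k. alex k (rel i)) \<in> row_space"
  by (auto simp: row_space_def if_distrib[of "\<lambda>x. x * _"] cong: if_cong
      intro!: exI[of _ "\<lambda>l. if l = i then 1 else 0"])

text \<open>Since \<open>r\<close> dies in \<open>G\<close>, the words \<open>g + r\<close> and
  \<open>g\<close> have the same monomial, and the contributions of \<open>g\<close> and
  \<open>- g\<close> cancel.\<close>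

lemma alex_conj:
  assumes "g \<in> F" "r \<in> F" "\<epsilon> r = \<one>\<^bsub>G\<^esub>"
  shows "alex j (g + r - g) = monomial g * alex j r"
proof -
  have "monomial (g + r) = monomial g"
    using assms by (simp add: monomial_def)
  then have "alex j (g + r + - g) = alex j g + monomial g * alex j r + monomial g * alex j (- g)"
    using assms by (simp add: alex_add del: add_uminus_conv_diff)
  also have "monomial g * alex j (- g) = - alex j g"
    using assms(1) monomial_uminus[of g] by (simp add: alex_uminus mult.assoc[symmetric])
  finally show ?thesis by simp
qed

text \<open>The kernel consists of products of conjugates of relators and their inverses.
  Conjugation only multiplies a row by a monomial, so the crossed homomorphism takes such a product
  to a combination of relator rows.\<close>

lemma alex_kernel:
  assumes "w \<in> F" "\<epsilon> w = \<one>\<^bsub>G\<^esub>"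
  shows "(\<lambda>k. alex k w) \<in> row_space"
proof -
  define H where "H = {g + r - g |g r. g \<in> F \<and> r \<in> rel ` {..<m - 1}}"
  have H_ker: "H \<subseteq> kernel (free_group m) G \<epsilon>"
    unfolding kernel_eq H_def by (blast intro: generate.incl)
  have "w \<in> generate (free_group m) H"
    using assms kernel_eq unfolding H_def by (auto simp: kernel_def)
  then show ?thesis
  proof (induction rule: generate.induct)
    case one
    then show ?case by simp
  next
    case (incl h)
    then obtain g i where "h = g + rel i - g" "g \<in> F" "i < m - 1"
      by (auto simp: H_def)
    then show ?case
      by (simp add: alex_conj rel_F eps_rel row_space_rel row_space_mult)
  next
    case (inv h)
    then obtain g i where h: "h = g + rel i - g" "g \<in> F" "i < m - 1"
      by (auto simp: H_def)
    then have "(\<lambda>k. alex k h) \<in> row_space"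
      by (simp add: alex_conj rel_F eps_rel row_space_rel row_space_mult)
    moreover have "h \<in> F"
      using H_ker inv by (auto simp: kernel_def)
    ultimately show ?case
      using row_space_mult[of "\<lambda>k. alex k h" "- monomial (- h)"] by (simp add: alex_uminus)
  next
    case (eng h1 h2)
    have "h1 \<in> F" "h2 \<in> F"
      using kernel_closure[OF eng(1) H_ker] kernel_closure[OF eng(2) H_ker] by auto
    then show ?case
      using row_space_add[OF eng(3) row_space_mult[OF eng(4)]] by (simp add: alex_add)
  qed
qed

text \<open>Modulo relations the crossed homomorphism descends to \<open>G\<close>, so lifts of
  group elements to words can be chosen freely.\<close>

lemma alex_eq_mod_row_space:
  assumes "u \<in> F" "w \<in> F" "\<epsilon> u = \<epsilon> w"
  shows "(\<lambda>k. alex k u - alex k w) \<in> row_space"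
proof -
  let ?v = "u + - w"
  have v: "?v \<in> F" "\<epsilon> ?v = \<one>\<^bsub>G\<^esub>"
    using assms by (simp_all del: add_uminus_conv_diff)
  have "alex k (?v + w) = alex k ?v + alex k w" for k
    unfolding alex_add[OF v(1) assms(2)] by (simp add: monomial_def v(2) del: add_uminus_conv_diff)
  then have "alex k u - alex k w = alex k ?v" for k
    by (simp add: algebra_simps)
  then show ?thesis
    using alex_kernel[OF v] by simp
qed

definition alex_minor :: "nat \<Rightarrow> int \<Rightarrow>\<^sub>0 int" where
  "alex_minor j = det (mat (m - 1) (m - 1) (\<lambda>(i, k). alex (skip j k) (rel i)))"

end

text \<open>The chain rule for the substitution of \<open>\<alpha> j\<close> for the generators of
  the second presentation. Any \<open>w\<close> with the same image in \<open>G\<close> may stand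
  for the substituted word. Thus the rows of the \<open>\<alpha> j\<close> induce a map of Alexander
  modules.\<close>

lemma alex_transition:
  assumes "meridional_presentation G \<phi> m1 \<epsilon>1 rel1" "meridional_presentation G \<phi> m2 \<epsilon>2 rel2"
    and \<alpha>: "\<And>j. j < m2 \<Longrightarrow> \<alpha> j \<in> carrier (free_group m1) \<and> \<epsilon>1 (\<alpha> j) = \<epsilon>2 (gen j)"
    and "v \<in> carrier (free_group m2)" "w \<in> carrier (free_group m1)" "\<epsilon>1 w = \<epsilon>2 v"
  shows "(\<lambda>k. (\<Sum>j<m2. meridional_presentation.alex \<phi> \<epsilon>2 j v * meridional_presentation.alex \<phi> \<epsilon>1 k (\<alpha> j))
      - meridional_presentation.alex \<phi> \<epsilon>1 k w)
    \<in> meridional_presentation.row_space \<phi> m1 \<epsilon>1 rel1"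
proof -
  interpret P1: meridional_presentation G \<phi> m1 \<epsilon>1 rel1 by fact
  interpret P2: meridional_presentation G \<phi> m2 \<epsilon>2 rel2 by fact
  define T where "T v k = (\<Sum>j<m2. P2.alex j v * P1.alex k (\<alpha> j))" for v k
  have "(\<lambda>k. T v k - P1.alex k w) \<in> P1.row_space"
    using assms(4-6)
  proof (induction arbitrary: w rule: free_group_induct)
    case zero
    then have "(\<lambda>k. - 1 * P1.alex k w) \<in> P1.row_space"
      by (intro P1.row_space_mult P1.alex_kernel) auto
    then show ?case by (simp add: T_def)
  next
    case (gen i v)
    \<comment> \<open>The induction hypothesis holds for every lift of \<open>v\<close>. The lift
      \<open>\<alpha> i + w'\<close> of \<open>gen i + v\<close> fits the recursion and is exchanged
      for \<open>w\<close> modulo the row space.\<close>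
    obtain w' where w': "w' \<in> P1.F" "\<epsilon>1 w' = \<epsilon>2 v"
      using P1.eps_surj[of "\<epsilon>2 v"] gen by auto
    have T: "T (gen i + v) k = P1.alex k (\<alpha> i) + laurent_var * T v k" for k
      using gen by (simp add: T_def P2.alex_add P2.alex_gen P2.monomial_gen distrib_right
          sum.distrib sum_distrib_left mult.assoc if_distrib[of "\<lambda>x. x * _"] cong: if_cong)
    have "P1.alex k (\<alpha> i + w') = P1.alex k (\<alpha> i) + laurent_var * P1.alex k w'" for k
      using gen(1) \<alpha>[of i] w' P2.phi_gen[of i] by (simp add: P1.alex_add P1.monomial_def)
    then have "T (gen i + v) k - P1.alex k w
        = laurent_var * (T v k - P1.alex k w') + (P1.alex k (\<alpha> i + w') - P1.alex k w)" for k
      by (simp add: T algebra_simps)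
    moreover have "(\<lambda>k. laurent_var * (T v k - P1.alex k w') + (P1.alex k (\<alpha> i + w') - P1.alex k w))
        \<in> P1.row_space"
      using gen \<alpha>[of i] w'
      by (intro P1.row_space_add P1.row_space_mult P1.alex_eq_mod_row_space) auto
    ultimately show ?case by (simp only:)
  next
    case (inv i v)
    obtain w' where w': "w' \<in> P1.F" "\<epsilon>1 w' = \<epsilon>2 v"
      using P1.eps_surj[of "\<epsilon>2 v"] inv by auto
    let ?u = "P2.monomial (- gen i)"
    have u: "P1.monomial (- \<alpha> i) = ?u"
      using inv(1) \<alpha>[of i] by (simp add: P1.monomial_def P2.monomial_def)
    have T: "T (- gen i + v) k = - (?u * P1.alex k (\<alpha> i)) + ?u * T v k" for k
      using inv by (simp add: T_def P2.alex_add P2.alex_uminus P2.alex_gen left_diff_distrib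
          sum_subtractf sum_distrib_left mult.assoc if_distrib[of "\<lambda>x. x * _"]
          if_distrib[of "\<lambda>x. _ * x"] cong: if_cong)
    have "P1.alex k (- \<alpha> i + w') = - (?u * P1.alex k (\<alpha> i)) + ?u * P1.alex k w'" for k
      using inv(1) \<alpha>[of i] w' by (simp add: P1.alex_add P1.alex_uminus u)
    then have "T (- gen i + v) k - P1.alex k w
        = ?u * (T v k - P1.alex k w') + (P1.alex k (- \<alpha> i + w') - P1.alex k w)" for k
      unfolding T by (simp add: algebra_simps)
    moreover have "(\<lambda>k. ?u * (T v k - P1.alex k w') + (P1.alex k (- \<alpha> i + w') - P1.alex k w))
        \<in> P1.row_space"
      using inv \<alpha>[of i] w'
      by (intro P1.row_space_add P1.row_space_mult P1.alex_eq_mod_row_space) auto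
    ultimately show ?case by (simp only:)
  qed
  then show ?thesis by (simp add: T_def)
qed

text \<open>Exchanging the presentations gives the converse divisibility, so the minors are
  associates. Taking one presentation twice compares different deleted columns.\<close>

lemma alex_minor_dvd:
  assumes "meridional_presentation G \<phi> m1 \<epsilon>1 rel1" "meridional_presentation G \<phi> m2 \<epsilon>2 rel2"
    and j: "j1 < m1" "j2 < m2"
  shows "meridional_presentation.alex_minor \<phi> m1 \<epsilon>1 rel1 j1 dvd
    meridional_presentation.alex_minor \<phi> m2 \<epsilon>2 rel2 j2"
proof -
  interpret P1: meridional_presentation G \<phi> m1 \<epsilon>1 rel1 by fact
  interpret P2: meridional_presentation G \<phi> m2 \<epsilon>2 rel2 by fact
  have "\<forall>j. \<exists>w. j < m2 \<longrightarrow> w \<in> P1.F \<and> \<epsilon>1 w = \<epsilon>2 (gen j)"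
    using P1.eps_surj by (metis P2.eps_closed gen_free_group)
  then obtain \<alpha> where \<alpha>: "\<And>j. j < m2 \<Longrightarrow> \<alpha> j \<in> P1.F \<and> \<epsilon>1 (\<alpha> j) = \<epsilon>2 (gen j)"
    by metis
  have "\<forall>j. \<exists>w. j < m1 \<longrightarrow> w \<in> P2.F \<and> \<epsilon>2 w = \<epsilon>1 (gen j)"
    using P2.eps_surj by (metis P1.eps_closed gen_free_group)
  then obtain \<beta> where \<beta>: "\<And>j. j < m1 \<Longrightarrow> \<beta> j \<in> P2.F \<and> \<epsilon>2 (\<beta> j) = \<epsilon>1 (gen j)"
    by metis
  \<comment> \<open>The map given by \<open>\<alpha>\<close> sends relations to relations, since
    \<open>rel2 l\<close> has the same image in \<open>G\<close> as the empty word. The coefficients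
    make up \<open>X\<close>.\<close>
  have "\<forall>l. \<exists>x. l < m2 - 1 \<longrightarrow> (\<forall>k<m1. (\<Sum>j<m2. P2.alex j (rel2 l) * P1.alex k (\<alpha> j))
      = (\<Sum>i<m1 - 1. x i * P1.alex k (rel1 i)))"
  proof (intro allI)
    fix l
    show "\<exists>x. l < m2 - 1 \<longrightarrow> (\<forall>k<m1. (\<Sum>j<m2. P2.alex j (rel2 l) * P1.alex k (\<alpha> j))
      = (\<Sum>i<m1 - 1. x i * P1.alex k (rel1 i)))"
      using alex_transition[OF assms(1,2) \<alpha>, of "rel2 l" 0] P2.rel_F[of l] P2.eps_rel[of l]
      by (cases "l < m2 - 1") (auto simp: P1.row_space_def)
  qed
  then obtain x where "\<forall>l. l < m2 - 1 \<longrightarrow> (\<forall>k<m1. (\<Sum>j<m2. P2.alex j (rel2 l) * P1.alex k (\<alpha> j))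
      = (\<Sum>i<m1 - 1. x l i * P1.alex k (rel1 i)))"
    by - (drule choice, elim exE, rule that)
  note x = this[rule_format]
  \<comment> \<open>Going over by \<open>\<beta>\<close> and back by \<open>\<alpha>\<close> is the
    identity modulo relations. The coefficients lead to \<open>W\<close>.\<close>
  have "\<forall>l. \<exists>w. l < m1 \<longrightarrow> (\<forall>k<m1. (\<Sum>j<m2. P2.alex j (\<beta> l) * P1.alex k (\<alpha> j))
      - P1.alex k (gen l) = (\<Sum>i<m1 - 1. w i * P1.alex k (rel1 i)))"
  proof (intro allI)
    fix l
    show "\<exists>w. l < m1 \<longrightarrow> (\<forall>k<m1. (\<Sum>j<m2. P2.alex j (\<beta> l) * P1.alex k (\<alpha> j))
      - P1.alex k (gen l) = (\<Sum>i<m1 - 1. w i * P1.alex k (rel1 i)))"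
      using alex_transition[OF assms(1,2) \<alpha>, of "\<beta> l" "gen l"] \<beta>[of l]
      by (cases "l < m1") (auto simp: P1.row_space_def)
  qed
  then obtain w where "\<forall>l. l < m1 \<longrightarrow> (\<forall>k<m1. (\<Sum>j<m2. P2.alex j (\<beta> l) * P1.alex k (\<alpha> j))
      - P1.alex k (gen l) = (\<Sum>i<m1 - 1. w l i * P1.alex k (rel1 i)))"
    by - (drule choice, elim exE, rule that)
  note w = this[rule_format]
  let ?a = "m1 - 1" and ?b = "m2 - 1"
  let ?s1 = "skip j1" and ?s2 = "skip j2"
  \<comment> \<open>Vectors with coordinate sum zero are spanned by the differences of the basis
    vectors at \<open>k\<close> and at \<open>j1\<close>, and their coordinates in this basis are
    their entries off \<open>j1\<close>. \<open>A\<close> and \<open>B\<close> are the transition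
    matrices between these differences, hence the subtraction of one row.\<close>
  define A where "A = mat ?b ?a (\<lambda>(i, k). P1.alex (?s1 k) (\<alpha> (?s2 i)) - P1.alex (?s1 k) (\<alpha> j2))"
  define B where "B = mat ?a ?b (\<lambda>(l, i). P2.alex (?s2 i) (\<beta> (?s1 l)) - P2.alex (?s2 i) (\<beta> j1))"
  define X where "X = mat ?b ?a (\<lambda>(l, i). x l i)"
  define W where "W = mat ?a ?a (\<lambda>(l, i). w (?s1 l) i - w j1 i)"
  define J1 where "J1 = mat ?a ?a (\<lambda>(i, k). P1.alex (?s1 k) (rel1 i))"
  define J2 where "J2 = mat ?b ?b (\<lambda>(i, k). P2.alex (?s2 k) (rel2 i))"
  note carr = A_def B_def X_def W_def J1_def J2_def
  \<comment> \<open>Rows of \<open>y\<close> that sum to zero allow the subtraction of the row \<open>\<alpha> j2\<close> in \<open>A\<close>.\<close>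
  have mult_A: "(\<Sum>i<?b. y (?s2 i) * (P1.alex k (\<alpha> (?s2 i)) - P1.alex k (\<alpha> j2)))
      = (\<Sum>i<m2. y i * P1.alex k (\<alpha> i))" if "(\<Sum>i<m2. y i) = 0" for y k
  proof -
    let ?c = "\<lambda>i. P1.alex k (\<alpha> i)"
    have "(\<Sum>i<?b. y (?s2 i) * (?c (?s2 i) - ?c j2)) = (\<Sum>i<m2. y i * (?c i - ?c j2)) - y j2 * (?c j2 - ?c j2)"
      by (rule sum_skip[OF j(2)])
    also have "\<dots> = (\<Sum>i<m2. y i * ?c i - y i * ?c j2)"
      by (simp only: diff_self mult_zero_right diff_zero right_diff_distrib)
    also have "\<dots> = (\<Sum>i<m2. y i * ?c i) - (\<Sum>i<m2. y i) * ?c j2"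
      by (simp only: sum_subtractf sum_distrib_right)
    finally show ?thesis
      by (simp only: that mult_zero_left diff_zero)
  qed
  have eq1: "J2 * A = X * J1"
  proof (rule eq_matI)
    fix l k assume "l < dim_row (X * J1)" "k < dim_col (X * J1)"
    then have lk: "l < ?b" "k < ?a" "?s1 k < m1"
      using j by (auto simp: carr skip_def)
    have "(J2 * A) $$ (l, k) = (\<Sum>i<?b. P2.alex (?s2 i) (rel2 l) *
        (P1.alex (?s1 k) (\<alpha> (?s2 i)) - P1.alex (?s1 k) (\<alpha> j2)))"
      using lk by (subst mult_mat_index[of _ ?b ?b _ ?a]) (auto simp: carr)
    also have "\<dots> = (\<Sum>i<m2. P2.alex i (rel2 l) * P1.alex (?s1 k) (\<alpha> i))"
      using lk by (intro mult_A[of "\<lambda>i. P2.alex i (rel2 l)"] P2.alex_row_sum_zero)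
        (simp_all add: P2.rel_F P2.eps_rel)
    also have "\<dots> = (\<Sum>i<?a. x l i * P1.alex (?s1 k) (rel1 i))"
      by (rule x[OF lk(1,3)])
    also have "\<dots> = (X * J1) $$ (l, k)"
      using lk by (subst mult_mat_index[of _ ?b ?a _ ?a]) (auto simp: carr)
    finally show "(J2 * A) $$ (l, k) = (X * J1) $$ (l, k)" .
  qed (simp_all add: carr)
  have eq2: "B * A = 1\<^sub>m ?a + W * J1"
  proof (rule eq_matI)
    fix l k assume "l < dim_row (1\<^sub>m ?a + W * J1)" "k < dim_col (1\<^sub>m ?a + W * J1)"
    then have lk: "l < ?a" "k < ?a" "?s1 k < m1" "?s1 l < m1"
      using j by (auto simp: carr skip_def)
    let ?y = "\<lambda>i. P2.alex i (\<beta> (?s1 l)) - P2.alex i (\<beta> j1)"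
    have "(\<Sum>i<m2. P2.alex i (\<beta> l)) = 1" if "l < m1" for l
      using \<beta>[OF that] P1.phi_gen[OF that] by (intro P2.alex_row_sum_one) auto
    then have y: "(\<Sum>i<m2. ?y i) = 0"
      using lk j by (simp add: sum_subtractf)
    have "(B * A) $$ (l, k) = (\<Sum>i<?b. ?y (?s2 i) *
        (P1.alex (?s1 k) (\<alpha> (?s2 i)) - P1.alex (?s1 k) (\<alpha> j2)))"
      using lk by (subst mult_mat_index[of _ ?a ?b _ ?a]) (auto simp: carr)
    also have "\<dots> = (\<Sum>i<m2. ?y i * P1.alex (?s1 k) (\<alpha> i))"
      by (rule mult_A[of ?y, OF y])
    also have "\<dots> = P1.alex (?s1 k) (gen (?s1 l)) - P1.alex (?s1 k) (gen j1)
        + ((\<Sum>i<?a. w (?s1 l) i * P1.alex (?s1 k) (rel1 i)) - (\<Sum>i<?a. w j1 i * P1.alex (?s1 k) (rel1 i)))"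
      using w[of "?s1 l" "?s1 k", symmetric] w[of j1 "?s1 k", symmetric] lk j
      by (simp add: left_diff_distrib sum_subtractf)
    \<comment> \<open>The function \<open>skip j1\<close> is injective and omits \<open>j1\<close>,
      so \<open>gen j1\<close> contributes zero.\<close>
    also have "\<dots> = (if l = k then 1 else 0) + (\<Sum>i<?a. (w (?s1 l) i - w j1 i) * P1.alex (?s1 k) (rel1 i))"
      by (auto simp: P1.alex_gen skip_def left_diff_distrib sum_subtractf)
    also have "(\<Sum>i<?a. (w (?s1 l) i - w j1 i) * P1.alex (?s1 k) (rel1 i)) = (W * J1) $$ (l, k)"
      using lk by (subst mult_mat_index[of _ ?a ?a _ ?a]) (auto simp: carr)
    also have "(if l = k then 1 else 0) + (W * J1) $$ (l, k) = (1\<^sub>m ?a + W * J1) $$ (l, k)"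
      using lk by (simp add: carr)
    finally show "(B * A) $$ (l, k) = (1\<^sub>m ?a + W * J1) $$ (l, k)" .
  qed (simp_all add: carr)
  have "det J1 dvd det J2"
    by (rule det_dvd_of_common_module[OF _ _ _ _ _ _ eq1 eq2]) (auto simp: carr)
  then show ?thesis
    by (simp add: P1.alex_minor_def P2.alex_minor_def J1_def J2_def)
qed

section \<open>Triangularization of representations modulo an integer\<close>

lemma sum_div_block:
  fixes g :: "nat \<Rightarrow> 'a::comm_monoid_add"
  assumes "s < q"
  shows "(\<Sum>y<k * q. if y div k = s then g y else 0) = (\<Sum>x<k. g (s * k + x))"
proof -
  have le: "s * k + k \<le> k * q"
    using assms mult_le_mono2[of "Suc s" q k] by (simp add: algebra_simps)
  have "(\<Sum>y<k * q. if y div k = s then g y else 0) = (\<Sum>y\<in>{y\<in>{..<k * q}. y div k = s}. g y)"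
    by (intro sum.inter_filter[symmetric]) simp
  also have "{y\<in>{..<k * q}. y div k = s} = (\<lambda>x. s * k + x) ` {..<k}"
  proof (intro equalityI subsetI)
    fix y assume y: "y \<in> {y\<in>{..<k * q}. y div k = s}"
    then have "y = s * k + y mod k" "k > 0"
      by (auto intro: gr0I)
    then show "y \<in> (\<lambda>x. s * k + x) ` {..<k}"
      using mod_less_divisor by blast
  qed (use le in auto)
  also have "(\<Sum>y\<in>\<dots>. g y) = (\<Sum>x<k. g (s * k + x))"
    by (simp add: sum.reindex inj_on_def)
  finally show ?thesis .
qed

lemma of_int_dvd: "x dvd y \<Longrightarrow> (of_int x :: 'b::comm_ring_1) dvd of_int y"
  by (auto elim!: dvdE)

text \<open>A Bezout relation between \<open>a ^ n\<close> and \<open>d\<close> over the integers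
  holds in every commutative ring and makes \<open>a\<close> invertible modulo
  \<open>d\<close>.\<close>

lemma dvd_of_mult_power_dvd:
  fixes x :: "'b::comm_ring_1"
  assumes "coprime a d" "of_int d dvd of_int a ^ n * x"
  shows "of_int d dvd x"
proof -
  obtain u v where "u * a ^ n + v * d = 1"
    using assms(1) by (metis cong_int_iff bezout_int coprime_iff_gcd_eq_1 coprime_power_left_iff)
  then have "of_int (u * a ^ n + v * d) = (1 :: 'b)"
    by simp
  then have "x = of_int u * (of_int a ^ n * x) + of_int d * (of_int v * x)"
    by (metis (no_types, lifting) distrib_right mult.assoc mult.commute mult_1 of_int_add of_int_mult of_int_power)
  with assms(2) show ?thesis
    by (metis dvd_add dvd_mult dvd_triv_left)
qed

text \<open>
  The blocks of the matrix are values of \<open>c \<otimes> \<rho>\<close>. Conjugation by \<open>P\<close>, which has the inverse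
  \<open>Q / a\<close>, turns \<open>\<rho>\<close> into the triangular \<open>T\<close> modulo \<open>d\<close>.
\<close>

lemma det_blocks_triangularized:
  fixes c :: "'w \<Rightarrow> 'b::idom" and \<rho> T :: "'w \<Rightarrow> nat \<Rightarrow> nat \<Rightarrow> int"
  assumes keys: "\<And>r s. r < q \<Longrightarrow> s < q \<Longrightarrow> Poly_Mapping.keys (z r s) \<subseteq> S"
    and similar: "\<And>w i j. w \<in> S \<Longrightarrow> i < k \<Longrightarrow> j < k \<Longrightarrow>
      d dvd (\<Sum>x<k. \<rho> w i x * P x j) - (\<Sum>x<k. P i x * T w x j)"
    and triangular: "\<And>w i j. w \<in> S \<Longrightarrow> j < i \<Longrightarrow> i < k \<Longrightarrow> T w i j = 0"
    and inverse: "\<And>i j. i < k \<Longrightarrow> j < k \<Longrightarrow> (\<Sum>x<k. Q i x * P x j) = (if i = j then a else 0)"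
    and "coprime a d"
  shows "of_int d dvd
      det (mat (k * q) (k * q) (\<lambda>(i, j).
        lin_ext (\<lambda>w. c w * of_int (\<rho> w (i mod k) (j mod k))) (z (i div k) (j div k))))
      - (\<Prod>i<k. det (mat q q (\<lambda>(r, s). lin_ext (\<lambda>w. c w * of_int (T w i i)) (z r s))))"
proof -
  let ?n = "k * q"
  \<comment> \<open>\<open>block R\<close> has \<open>q\<close> diagonal copies of \<open>R\<close>;
    \<open>twist R\<close> has as block (r, s) the value of \<open>c \<otimes> R\<close> at
    \<open>z r s\<close>. The identities to be shown are
    \<open>twist \<rho> * ?P = ?P * twist T\<close> modulo \<open>d\<close> and
    \<open>?Q * ?P = a\<close>.\<close>
  define block :: "(nat \<Rightarrow> nat \<Rightarrow> int) \<Rightarrow> 'b mat" where "block R = mat ?n ?n (\<lambda>(i, j).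
    if i div k = j div k then of_int (R (i mod k) (j mod k)) else 0)" for R
  define twist where "twist R = mat ?n ?n (\<lambda>(i, j).
    lin_ext (\<lambda>w. c w * of_int (R w (i mod k) (j mod k))) (z (i div k) (j div k)))" for R :: "'w \<Rightarrow> nat \<Rightarrow> nat \<Rightarrow> int"
  let ?P = "block P" and ?Q = "block Q"
  have carr [simp]: "block R \<in> carrier_mat ?n ?n" "twist R' \<in> carrier_mat ?n ?n" for R R'
    by (simp_all add: block_def twist_def)
  have idx: "i div k < q" "i mod k < k" if "i < ?n" for i
    using that by (simp_all add: less_mult_imp_div_less mult.commute) (cases k; simp)
  have idx2: "s * k + x < ?n" if "s < q" "x < k" for s x
    using that mult_le_mono2[of "Suc s" q k] by (simp add: algebra_simps)
  have MP: "(twist \<rho> * ?P) $$ (i, j) =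
      lin_ext (\<lambda>w. c w * of_int (\<Sum>x<k. \<rho> w (i mod k) x * P x (j mod k))) (z (i div k) (j div k))"
    if ij: "i < ?n" "j < ?n" for i j
  proof -
    have "(twist \<rho> * ?P) $$ (i, j) = (\<Sum>y<?n. if y div k = j div k then
        twist \<rho> $$ (i, y) * of_int (P (y mod k) (j mod k)) else 0)"
      using ij by (subst mult_mat_index[of _ ?n ?n _ ?n]) (auto simp: block_def intro!: sum.cong)
    also have "\<dots> = (\<Sum>x<k. twist \<rho> $$ (i, j div k * k + x)
        * of_int (P ((j div k * k + x) mod k) (j mod k)))"
      using idx ij by (intro sum_div_block) auto
    also have "\<dots> = (\<Sum>x<k. lin_ext (\<lambda>w. c w * of_int (\<rho> w (i mod k) x * P x (j mod k))) (z (i div k) (j div k)))"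
      using idx2 idx ij by (intro sum.cong) (auto simp: twist_def lin_ext_mult_right mult.assoc)
    finally show ?thesis
      by (simp add: lin_ext_sum_fun sum_distrib_left)
  qed
  have PT: "(?P * twist T) $$ (i, j) =
      lin_ext (\<lambda>w. c w * of_int (\<Sum>x<k. P (i mod k) x * T w x (j mod k))) (z (i div k) (j div k))"
    if ij: "i < ?n" "j < ?n" for i j
  proof -
    have "(?P * twist T) $$ (i, j) = (\<Sum>y<?n. if y div k = i div k then
        twist T $$ (y, j) * of_int (P (i mod k) (y mod k)) else 0)"
      using ij by (subst mult_mat_index[of _ ?n ?n _ ?n])
        (auto simp: block_def mult.commute intro!: sum.cong)
    also have "\<dots> = (\<Sum>x<k. twist T $$ (i div k * k + x, j)
        * of_int (P (i mod k) ((i div k * k + x) mod k)))"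
      using idx ij by (intro sum_div_block) auto
    also have "\<dots> = (\<Sum>x<k. lin_ext (\<lambda>w. c w * of_int (P (i mod k) x * T w x (j mod k))) (z (i div k) (j div k)))"
    proof (rule sum.cong)
      fix x assume x: "x \<in> {..<k}"
      then have "twist T $$ (i div k * k + x, j)
          = lin_ext (\<lambda>w. c w * of_int (T w x (j mod k))) (z (i div k) (j div k))"
        using idx2 idx ij by (simp add: twist_def)
      then show "twist T $$ (i div k * k + x, j) * of_int (P (i mod k) ((i div k * k + x) mod k))
          = lin_ext (\<lambda>w. c w * of_int (P (i mod k) x * T w x (j mod k))) (z (i div k) (j div k))"
        using x by (simp add: lin_ext_mult_right) (simp add: mult_ac)
    qed simp
    finally show ?thesis
      by (simp add: lin_ext_sum_fun sum_distrib_left)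
  qed
  have QP: "?Q * ?P = of_int a \<cdot>\<^sub>m 1\<^sub>m ?n"
  proof (rule eq_matI)
    fix i j assume "i < dim_row (of_int a \<cdot>\<^sub>m (1\<^sub>m ?n :: 'b mat))" "j < dim_col (of_int a \<cdot>\<^sub>m (1\<^sub>m ?n :: 'b mat))"
    then have ij: "i < ?n" "j < ?n" by simp_all
    have "(?Q * ?P) $$ (i, j) = (\<Sum>y<?n. if y div k = i div k then
        of_int (Q (i mod k) (y mod k)) * ?P $$ (y, j) else 0)"
      using ij by (subst mult_mat_index[of _ ?n ?n _ ?n]) (auto simp: block_def intro!: sum.cong)
    also have "\<dots> = (\<Sum>x<k. of_int (Q (i mod k) ((i div k * k + x) mod k)) * ?P $$ (i div k * k + x, j))"
      using idx ij by (intro sum_div_block) auto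
    also have "\<dots> = (if i div k = j div k then of_int (\<Sum>x<k. Q (i mod k) x * P x (j mod k)) else 0)"
      using idx2 idx ij by (auto simp: block_def intro!: sum.cong)
    also have "\<dots> = (if i = j then of_int a else 0)"
    proof -
      have "i = j \<longleftrightarrow> i div k = j div k \<and> i mod k = j mod k"
        by (metis div_mult_mod_eq)
      then show ?thesis
        using inverse idx ij by auto
    qed
    finally show "(?Q * ?P) $$ (i, j) = (of_int a \<cdot>\<^sub>m 1\<^sub>m ?n) $$ (i, j)"
      using ij by simp
  qed (simp_all add: block_def)
  have "of_int d dvd det (twist \<rho> * ?P) - det (?P * twist T)"
  proof (rule det_dvd_diff[of _ ?n])
    fix i j assume ij: "i < ?n" "j < ?n"
    show "of_int d dvd (twist \<rho> * ?P) $$ (i, j) - (?P * twist T) $$ (i, j)"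
      unfolding MP[OF ij] PT[OF ij]
    proof (rule lin_ext_dvd_diff)
      fix w assume "w \<in> Poly_Mapping.keys (z (i div k) (j div k))"
      then have "d dvd (\<Sum>x<k. \<rho> w (i mod k) x * P x (j mod k)) - (\<Sum>x<k. P (i mod k) x * T w x (j mod k))"
        using similar keys idx ij by blast
      then show "of_int d dvd c w * of_int (\<Sum>x<k. \<rho> w (i mod k) x * P x (j mod k))
          - c w * of_int (\<Sum>x<k. P (i mod k) x * T w x (j mod k))"
        by (simp only: of_int_diff[symmetric] right_diff_distrib[symmetric] of_int_dvd dvd_mult)
    qed
  qed (auto intro: mult_carrier_mat[of _ ?n ?n])
  then have "of_int d dvd (det (twist \<rho>) - det (twist T)) * det ?P"
    by (simp add: det_mult[of _ ?n] algebra_simps)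
  \<comment> \<open>Multiplication by \<open>det ?Q\<close> turns the factor \<open>det ?P\<close>
    into a power of \<open>a\<close>, which can be cancelled modulo \<open>d\<close>.\<close>
  then have "of_int d dvd det ?Q * ((det (twist \<rho>) - det (twist T)) * det ?P)"
    by (rule dvd_mult)
  moreover have "det ?Q * det ?P = of_int a ^ ?n"
    using arg_cong[OF QP, of det] by (simp add: det_mult[of _ ?n])
  ultimately have "of_int d dvd of_int a ^ ?n * (det (twist \<rho>) - det (twist T))"
    by (metis mult.assoc mult.commute)
  then have "of_int d dvd det (twist \<rho>) - det (twist T)"
    by (rule dvd_of_mult_power_dvd[OF \<open>coprime a d\<close>])
  moreover have "det (twist T) = (\<Prod>i<k. det (mat q q (\<lambda>(r, s). twist T $$ (r * k + i, s * k + i))))"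
  proof (rule det_block_upper_triangular)
    fix i j assume ij: "i < ?n" "j < ?n" "j mod k < i mod k"
    have "lin_ext (\<lambda>w. c w * of_int (T w (i mod k) (j mod k))) (z (i div k) (j div k))
        = lin_ext (\<lambda>w. 0) (z (i div k) (j div k))"
      using keys[of "i div k" "j div k"] idx ij triangular by (intro lin_ext_cong) auto
    then show "twist T $$ (i, j) = 0"
      using ij by (simp add: twist_def lin_ext_def)
  qed simp
  moreover have "mat q q (\<lambda>(r, s). twist T $$ (r * k + i, s * k + i))
      = mat q q (\<lambda>(r, s). lin_ext (\<lambda>w. c w * of_int (T w i i)) (z r s))" if "i < k" for i
    using that idx2 by (intro eq_matI) (auto simp: twist_def)
  ultimately show ?thesis
    by (simp add: twist_def)
qed

section \<open>The regular representation of the dihedral group\<close>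

text \<open>Binomial inversion: trinomial revision takes (i choose j) out of the sum, and an
  alternating sum of binomial coefficients remains.\<close>

lemma sum_choose_inversion:
  "(\<Sum>u\<le>i. (-1) ^ (i + u) * int (i choose u) * int (u choose j)) = (if i = j then 1 else 0)"
proof (cases "j \<le> i")
  case False
  then show ?thesis by (auto intro!: sum.neutral)
next
  case True
  have "(\<Sum>u\<le>i. (-1) ^ (i + u) * int (i choose u) * int (u choose j))
      = (\<Sum>u=j..i. (-1) ^ (i + u) * int (i choose u) * int (u choose j))"
    by (intro sum.mono_neutral_right) auto
  also have "\<dots> = (\<Sum>u=0 + j..(i - j) + j. (-1) ^ (i + u) * int (i choose u) * int (u choose j))"
    using True by simp
  also have "\<dots> = (\<Sum>v=0..i - j. (-1) ^ (i + (v + j)) * int (i choose (v + j)) * int ((v + j) choose j))"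
    by (rule sum.shift_bounds_cl_nat_ivl)
  also have "\<dots> = (\<Sum>v\<le>i - j. (-1) ^ (i + j) * int (i choose j) * ((-1) ^ v * int ((i - j) choose v)))"
    unfolding atLeast0AtMost
  proof (rule sum.cong)
    fix v assume "v \<in> {..i - j}"
    then have "(i choose (v + j)) * ((v + j) choose j) = (i choose j) * ((i - j) choose v)"
      using choose_mult[of j "v + j" i] True by simp
    then show "(-1) ^ (i + (v + j)) * int (i choose (v + j)) * int ((v + j) choose j)
        = (-1) ^ (i + j) * int (i choose j) * ((-1) ^ v * int ((i - j) choose v))"
      by (simp add: power_add mult.assoc flip: of_nat_mult)
  qed simp
  also have "\<dots> = (-1) ^ (i + j) * int (i choose j) * (\<Sum>v\<le>i - j. (-1) ^ v * int ((i - j) choose v))"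
    by (simp only: sum_distrib_left)
  also have "\<dots> = (if i = j then 1 else 0)"
    using choose_alternating_sum[of "i - j", where 'a = int] True by auto
  finally show ?thesis .
qed

text \<open>By absorption \<open>p ^ n\<close> divides \<open>j\<close> times the coefficient. If
  \<open>p\<close> did not divide the coefficient, \<open>p ^ n\<close> would divide the smaller
  positive number \<open>j\<close>.\<close>

lemma prime_dvd_choose_mult_power:
  fixes p :: nat
  assumes "prime p" "0 < j" "j < p ^ n"
  shows "p dvd (p ^ n * q) choose j"
proof (rule ccontr)
  assume "\<not> p dvd (p ^ n * q) choose j"
  then have cop: "coprime (p ^ n) ((p ^ n * q) choose j)"
    using assms(1) by (simp add: prime_imp_coprime)
  have "j * ((p ^ n * q) choose j) = p ^ n * q * ((p ^ n * q - 1) choose (j - 1))"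
    using binomial_absorption[of "j - 1" "p ^ n * q"] assms(2) by simp
  then have "p ^ n dvd j * ((p ^ n * q) choose j)"
    by (metis dvd_triv_left mult.assoc)
  then have "p ^ n dvd j"
    using cop coprime_dvd_mult_left_iff by blast
  with assms show False
    by (auto dest: dvd_imp_le)
qed

text \<open>Modulo \<open>p\<close> only the term \<open>k = 0\<close> of a Vandermonde sum
  survives. Here \<open>h\<close> is either an ordinary binomial coefficient or one with negative
  upper argument.\<close>

lemma choose_cong_of_convolution:
  fixes p :: nat and h :: "nat \<Rightarrow> int"
  assumes "prime p" "i < p ^ n"
    and "int (w choose i) = (\<Sum>k\<le>i. int ((p ^ n * q) choose k) * h (i - k))"
  shows "int p dvd int (w choose i) - h i"
proof -
  have "int (w choose i) = h i + (\<Sum>k\<in>{..i} - {0}. int ((p ^ n * q) choose k) * h (i - k))"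
    unfolding assms(3) by (subst sum.remove[of _ 0]) auto
  moreover have "int p dvd (\<Sum>k\<in>{..i} - {0}. int ((p ^ n * q) choose k) * h (i - k))"
    using prime_dvd_choose_mult_power[OF assms(1)] assms(2) by (intro dvd_sum) auto
  ultimately show ?thesis by simp
qed

text \<open>Periodicity: modulo \<open>p\<close>, binomial functions of degree below
  \<open>p ^ n\<close> live on the integers modulo \<open>p ^ n\<close>.\<close>

lemma choose_mod_prime_power:
  fixes p :: nat
  assumes "prime p" "i < p ^ n"
  shows "int p dvd int (w mod p ^ n choose i) - int (w choose i)"
proof -
  have "(w choose i) = (\<Sum>k\<le>i. (p ^ n * (w div p ^ n) choose k) * (w mod p ^ n choose (i - k)))"
    unfolding vandermonde by simp
  then have "int p dvd int (w choose i) - int (w mod p ^ n choose i)"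
    using assms by (intro choose_cong_of_convolution[where q = "w div p ^ n" and n = n
          and h = "\<lambda>k. int (w mod p ^ n choose k)"]) simp_all
  then show ?thesis
    by (metis dvd_minus_iff minus_diff_eq)
qed

text \<open>Here \<open>w'\<close> represents \<open>- w\<close> modulo \<open>p ^ n\<close>, so
  periodicity leads to the coefficient with upper argument \<open>- w\<close>, which upper negation
  makes a natural number again. The generalized coefficients are taken over the rationals.\<close>

lemma choose_neg_mod_prime_power:
  fixes p :: nat
  assumes "prime p" "i < p ^ n" "w + w' = p ^ n * q"
  shows "int p dvd int (w' choose i) - (-1) ^ i * int (w + i - 1 choose i)"
proof (rule choose_cong_of_convolution[where q = q and n = n])
  have minus: "(- of_nat w gchoose k) = (of_int ((-1) ^ k * int (w + k - 1 choose k)) :: rat)" for k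
  proof (cases k)
    case (Suc l)
    have "(of_nat w + of_nat k - 1 :: rat) = of_nat (w + k - 1)"
      by (simp add: Suc)
    then show ?thesis
      unfolding gbinomial_minus by (simp only: binomial_gbinomial[symmetric]) simp
  qed simp
  have w': "(of_nat w' :: rat) = of_nat (p ^ n * q) + - of_nat w"
    unfolding assms(3)[symmetric] by simp
  have "of_int (int (w' choose i)) = (of_nat w' gchoose i :: rat)"
    by (simp add: binomial_gbinomial)
  also have "\<dots> = (\<Sum>k=0..i. (of_nat (p ^ n * q) gchoose k) * (- of_nat w gchoose (i - k)))"
    unfolding w' by (rule gbinomial_Vandermonde[symmetric])
  also have "\<dots> = of_int (\<Sum>k\<le>i. int (p ^ n * q choose k) * ((-1) ^ (i - k) * int (w + (i - k) - 1 choose (i - k))))"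
    unfolding minus atLeast0AtMost by (simp add: binomial_gbinomial del: of_nat_mult)
  finally show "int (w' choose i) = (\<Sum>k\<le>i. int (p ^ n * q choose k) * ((-1) ^ (i - k) * int (w + (i - k) - 1 choose (i - k))))"
    by (simp only: of_int_eq_iff)
qed (use assms in auto)

text \<open>
  Put \<open>u = s * a\<close> for the element \<open>(a, s)\<close>. In the coordinates \<open>(s, u)\<close>, right multiplication by
  \<open>(c, s')\<close> is \<open>(s, u) \<mapsto> (s s', s' (u + c))\<close>. It permutes the functions on the group, for which
  \<open>s ^ \<delta> * (u choose i)\<close> with \<open>\<delta> < 2\<close> and \<open>i < N\<close> is a basis modulo \<open>p\<close>. It preserves \<open>\<delta>\<close> and does
  not raise the degree \<open>i\<close>. The basis is indexed by \<open>x = \<delta> * N + i\<close>.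
\<close>

definition dihedral_coord :: "nat \<Rightarrow> int \<times> int \<Rightarrow> nat" where
  "dihedral_coord N h = nat ((snd h * fst h) mod int N)"

definition dihedral_basis :: "nat \<Rightarrow> int \<times> int \<Rightarrow> nat \<Rightarrow> int" where
  "dihedral_basis N h x = snd h ^ (x div N) * int (dihedral_coord N h choose (x mod N))"

text \<open>Twice the inverse of the matrix of \<open>dihedral_basis\<close>: binomial inversion in
  the coordinate, characters of {1, -1} in the sign.\<close>

definition dihedral_dual :: "nat \<Rightarrow> int \<times> int \<Rightarrow> nat \<Rightarrow> int" where
  "dihedral_dual N h x = snd h ^ (x div N) *
     ((-1) ^ (x mod N + dihedral_coord N h) * int (x mod N choose dihedral_coord N h))"

text \<open>The Vandermonde coefficients of (u choose v) in (u + c choose i) for a rotation, and in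
  (-1)^i (u + c + i - 1 choose i), which is (-(u + c) choose i), for a reflection.\<close>

definition dihedral_triangular :: "nat \<Rightarrow> int \<times> int \<Rightarrow> nat \<Rightarrow> nat \<Rightarrow> int" where
  "dihedral_triangular N g y x =
     (if y div N = x div N \<and> y mod N \<le> x mod N then
        snd g ^ (x div N) *
          (if snd g = 1 then int (nat (fst g) choose (x mod N - y mod N))
           else (-1) ^ (x mod N) * int (nat (fst g) + x mod N - 1 choose (x mod N - y mod N)))
      else 0)"

lemma dihedral_triangular_zero: "x < y \<Longrightarrow> dihedral_triangular N g y x = 0"
  unfolding dihedral_triangular_def
  by (metis (no_types, lifting) add_le_cancel_left div_mult_mod_eq leD)

lemma dihedral_triangular_diag:
  "g \<in> carrier (dihedral_group N) \<Longrightarrow>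
    dihedral_triangular N g x x = snd g ^ (x div N + x mod N)"
  by (auto simp: dihedral_triangular_def dihedral_group_def power_add)

text \<open>The coordinate of the product is \<open>s' * (u + c)\<close> modulo \<open>N\<close>.
  Periodicity for \<open>s' = 1\<close> and upper negation for \<open>s' = -1\<close> lead to a
  binomial coefficient of a sum, to which Vandermonde's identity applies.\<close>

lemma dihedral_mult_basis:
  fixes p :: nat
  assumes "prime p" and N: "N = p ^ n" and x: "x < N * 2"
    and h: "h \<in> carrier (dihedral_group N)" and g: "g \<in> carrier (dihedral_group N)"
  shows "int p dvd dihedral_basis N (h \<otimes>\<^bsub>dihedral_group N\<^esub> g) x
    - (\<Sum>y<N * 2. dihedral_basis N h y * dihedral_triangular N g y x)"
proof -
  obtain a s where hs: "h = (a, s)" "0 \<le> a" "a < int N" "s = 1 \<or> s = -1"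
    using h by (auto simp: dihedral_group_def)
  obtain c s' where gs: "g = (c, s')" "0 \<le> c" "c < int N" "s' = 1 \<or> s' = -1"
    using g by (auto simp: dihedral_group_def)
  have N0: "N > 0"
    using hs by simp
  define \<delta> i u where "\<delta> = x div N" and "i = x mod N" and "u = dihedral_coord N h"
  have \<delta>: "\<delta> < 2" and i: "i < N"
    using x N0 by (simp_all add: \<delta>_def i_def less_mult_imp_div_less mult.commute)
  define t :: "nat \<Rightarrow> int" where "t v = (if s' = 1 then int (nat c choose (i - v))
    else (-1) ^ i * int (nat c + i - 1 choose (i - v)))" for v
  have "(\<Sum>y<N * 2. dihedral_basis N h y * dihedral_triangular N g y x)
      = (\<Sum>y<N * 2. if y div N = \<delta> then
          (if y mod N \<le> i then s ^ \<delta> * int (u choose (y mod N)) * (s' ^ \<delta> * t (y mod N)) else 0) else 0)"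
    by (intro sum.cong)
      (auto simp: dihedral_basis_def dihedral_triangular_def hs(1) gs(1) \<delta>_def i_def u_def t_def)
  also have "\<dots> = (\<Sum>v<N. if (\<delta> * N + v) mod N \<le> i then
      s ^ \<delta> * int (u choose ((\<delta> * N + v) mod N)) * (s' ^ \<delta> * t ((\<delta> * N + v) mod N)) else 0)"
    by (rule sum_div_block[OF \<delta>])
  also have "\<dots> = (\<Sum>v<N. if v \<le> i then s ^ \<delta> * int (u choose v) * (s' ^ \<delta> * t v) else 0)"
    by (intro sum.cong) simp_all
  also have "\<dots> = (\<Sum>v\<in>{v\<in>{..<N}. v \<le> i}. s ^ \<delta> * int (u choose v) * (s' ^ \<delta> * t v))"
    by (rule sum.inter_filter[symmetric]) simp
  also have "{v\<in>{..<N}. v \<le> i} = {..i}"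
    using i by auto
  also have "(\<Sum>v\<le>i. s ^ \<delta> * int (u choose v) * (s' ^ \<delta> * t v))
      = (s * s') ^ \<delta> * (\<Sum>v\<le>i. int (u choose v) * t v)"
    by (simp add: sum_distrib_left power_mult_distrib mult_ac)
  finally have sum_eq: "(\<Sum>y<N * 2. dihedral_basis N h y * dihedral_triangular N g y x)
      = (s * s') ^ \<delta> * (\<Sum>v\<le>i. int (u choose v) * t v)" .
  have u_eq: "int u = (s * a) mod int N"
    using N0 by (simp add: u_def dihedral_coord_def hs(1))
  define u' where "u' = dihedral_coord N (h \<otimes>\<^bsub>dihedral_group N\<^esub> g)"
  have "int u' = (s * s' * ((a + s * c) mod int N)) mod int N"
    using N0 by (simp add: u'_def dihedral_coord_def hs(1) gs(1) dihedral_group_def)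
  also have "\<dots> = (s * s' * (a + s * c)) mod int N"
    by (rule mod_mult_right_eq)
  also have "s * s' * (a + s * c) = s' * (s * a + s * s * c)"
    by (simp add: algebra_simps)
  also have "s * s = 1"
    using hs(4) by auto
  also have "(s' * (s * a + 1 * c)) mod int N = (s' * (int u + c)) mod int N"
    unfolding u_eq by (intro mod_mult_cong) (simp_all add: mod_add_left_eq)
  finally have u': "int u' = (s' * (int u + c)) mod int N" .
  have "int p dvd int (u' choose i) - (\<Sum>v\<le>i. int (u choose v) * t v)"
  proof (cases "s' = 1")
    case True
    have "int u' = int ((u + nat c) mod N)"
      unfolding u' using True gs(2) by (simp add: zmod_int)
    then have "u' = (u + nat c) mod N"
      by (simp only: of_nat_eq_iff)
    moreover have "(\<Sum>v\<le>i. int (u choose v) * t v) = int (u + nat c choose i)"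
      using vandermonde[of u "nat c" i] True by (simp add: t_def flip: of_nat_mult of_nat_sum)
    ultimately show ?thesis
      using choose_mod_prime_power[OF assms(1), of i n "u + nat c"] i by (simp add: N)
  next
    case False
    with gs have s': "s' = -1" by simp
    have "int N dvd (int u + c) + (- (int u + c)) mod int N"
      unfolding dvd_eq_mod_eq_0 mod_add_right_eq by simp
    then have "int N dvd int (u + nat c + u')"
      using gs(2) unfolding of_nat_add u' s' by simp
    then have "N dvd u + nat c + u'"
      by (simp only: of_nat_dvd_iff)
    then obtain q where "u + nat c + u' = p ^ n * q"
      by (auto simp: N elim: dvdE)
    then have "int p dvd int (u' choose i) - (-1) ^ i * int (u + nat c + i - 1 choose i)"
      using i unfolding N by (intro choose_neg_mod_prime_power[OF assms(1)])
    moreover have "(\<Sum>v\<le>i. int (u choose v) * t v) = (-1) ^ i * int (u + nat c + i - 1 choose i)"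
    \<comment> \<open>For \<open>i = 0\<close> the truncated subtraction forbids the regrouping to
      \<open>u + (nat c + i - 1)\<close>; there both sides are 1.\<close>
    proof (cases i)
      case (Suc l)
      then have "u + nat c + i - 1 = u + (nat c + i - 1)"
        by simp
      then have "int (u + nat c + i - 1 choose i) = (\<Sum>v\<le>i. int (u choose v) * int (nat c + i - 1 choose (i - v)))"
        by (simp only: vandermonde[symmetric] of_nat_sum of_nat_mult)
      then show ?thesis
        using s' by (simp add: t_def sum_distrib_left mult_ac)
    qed (simp add: t_def s')
    ultimately show ?thesis by simp
  qed
  then have "int p dvd (s * s') ^ \<delta> * (int (u' choose i) - (\<Sum>v\<le>i. int (u choose v) * t v))"
    by (rule dvd_mult)
  moreover have "dihedral_basis N (h \<otimes>\<^bsub>dihedral_group N\<^esub> g) x = (s * s') ^ \<delta> * int (u' choose i)"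
    by (simp add: dihedral_basis_def \<delta>_def i_def u'_def) (simp add: hs(1) gs(1) dihedral_group_def)
  ultimately show ?thesis
    unfolding sum_eq by (simp add: right_diff_distrib)
qed

text \<open>The coordinate part is binomial inversion. The factor 2 is the orthogonality relation of
  the two characters of {1, -1}.\<close>

lemma dihedral_dual_basis:
  assumes x: "x < N * 2" and y: "y < N * 2"
  shows "(\<Sum>h\<in>carrier (dihedral_group N). dihedral_dual N h x * dihedral_basis N h y)
    = (if x = y then 2 else 0)"
proof -
  have N0: "N > 0"
    using x by (cases N) auto
  define \<delta> i \<delta>' j where "\<delta> = x div N" and "i = x mod N" and "\<delta>' = y div N" and "j = y mod N"
  have lt: "\<delta> < 2" "i < N" "\<delta>' < 2" "j < N"
    using x y N0 by (simp_all add: \<delta>_def i_def \<delta>'_def j_def less_mult_imp_div_less mult.commute)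
  define F where "F u = (-1) ^ (i + u) * int (i choose u) * int (u choose j)" for u
  have F: "(\<Sum>u<N. F u) = (if i = j then 1 else 0)"
  proof -
    have "(\<Sum>u<N. F u) = (\<Sum>u\<le>i. F u)"
      using lt by (intro sum.mono_neutral_right) (auto simp: F_def)
    then show ?thesis
      using sum_choose_inversion[of i j] by (simp add: F_def)
  qed
  have inner: "(\<Sum>a\<in>{0..<int N}. dihedral_dual N (a, s) x * dihedral_basis N (a, s) y)
      = s ^ (\<delta> + \<delta>') * (if i = j then 1 else 0)" if s: "s \<in> {1, -1}" for s
  proof -
    have ss: "s * (s * z) = z" for z
      using s by auto
    \<comment> \<open>Multiplication by \<open>s\<close> is an involution modulo \<open>N\<close>,
      so summing over \<open>a\<close> is summing over the coordinate.\<close>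
    have "bij_betw (\<lambda>a. nat ((s * a) mod int N)) {0..<int N} {..<N}"
    proof (rule bij_betw_byWitness[where f' = "\<lambda>u. (s * int u) mod int N"])
      show "\<forall>a\<in>{0..<int N}. (s * int (nat ((s * a) mod int N))) mod int N = a"
        using N0 by (simp add: mod_mult_right_eq ss)
      show "\<forall>u\<in>{..<N}. nat ((s * ((s * int u) mod int N)) mod int N) = u"
        using N0 by (simp add: mod_mult_right_eq ss)
    qed (use N0 in \<open>auto simp: nat_less_iff\<close>)
    then have "(\<Sum>u<N. s ^ (\<delta> + \<delta>') * F u) = (\<Sum>a\<in>{0..<int N}. s ^ (\<delta> + \<delta>') * F (nat ((s * a) mod int N)))"
      by (rule sum.reindex_bij_betw[symmetric])
    also have "\<dots> = (\<Sum>a\<in>{0..<int N}. dihedral_dual N (a, s) x * dihedral_basis N (a, s) y)"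
      by (simp add: dihedral_dual_def dihedral_basis_def dihedral_coord_def F_def power_add
          \<delta>_def \<delta>'_def i_def j_def mult_ac)
    finally show ?thesis
      by (simp add: F flip: sum_distrib_left)
  qed
  have "(\<Sum>h\<in>carrier (dihedral_group N). dihedral_dual N h x * dihedral_basis N h y)
      = (\<Sum>a\<in>{0..<int N}. \<Sum>s\<in>{1, -1}. dihedral_dual N (a, s) x * dihedral_basis N (a, s) y)"
    by (simp only: dihedral_group_def partial_object.simps sum.cartesian_product case_prod_unfold
        prod.collapse)
  also have "\<dots> = (\<Sum>s\<in>{1, -1}. \<Sum>a\<in>{0..<int N}. dihedral_dual N (a, s) x * dihedral_basis N (a, s) y)"
    by (rule sum.swap)
  also have "\<dots> = (\<Sum>s\<in>{1, -1}. s ^ (\<delta> + \<delta>') * (if i = j then 1 else 0))"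
    using inner by (intro sum.cong) auto
  also have "\<dots> = (if \<delta> = \<delta>' \<and> i = j then 2 else 0)"
    using lt by (auto simp: less_2_cases_iff)
  also have "\<delta> = \<delta>' \<and> i = j \<longleftrightarrow> x = y"
    unfolding \<delta>_def \<delta>'_def i_def j_def by (metis div_mult_mod_eq)
  finally show ?thesis .
qed

text \<open>Row \<open>a\<close> has its only 1 at the index of the product of \<open>e a\<close>
  with \<open>g\<close>. On columns of function values the matrix therefore acts by right
  translation.\<close>

lemma regular_representation_mult:
  assumes "bij_betw e {..<k} (carrier G)" "group G" "g \<in> carrier G" "a < k"
  shows "(\<Sum>x<k. regular_representation G e g $$ (a, x) * F (e x)) = F (e a \<otimes>\<^bsub>G\<^esub> g)"
proof -
  have k: "order G = k"
    using bij_betw_same_card[OF assms(1)] by (simp add: order_def)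
  have "e a \<otimes>\<^bsub>G\<^esub> g \<in> carrier G"
    using assms by (meson bij_betwE group.is_monoid lessThan_iff monoid.m_closed)
  then obtain y where y: "y < k" "e y = e a \<otimes>\<^bsub>G\<^esub> g"
    using assms(1) by (auto simp: bij_betw_def image_iff dest!: equalityD2[THEN subsetD])
  have "(\<Sum>x<k. regular_representation G e g $$ (a, x) * F (e x)) = (\<Sum>x<k. if y = x then F (e x) else 0)"
  proof (rule sum.cong)
    fix x assume "x \<in> {..<k}"
    moreover from this have "e y = e x \<longleftrightarrow> y = x"
      using assms(1) y(1) by (auto simp: bij_betw_def inj_on_eq_iff)
    ultimately show "regular_representation G e g $$ (a, x) * F (e x) = (if y = x then F (e x) else 0)"
      using assms(4) by (simp add: regular_representation_def k y(2)[symmetric])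
  qed simp
  also have "\<dots> = F (e y)"
    using y(1) by simp
  finally show ?thesis
    by (simp add: y(2))
qed

lemma prod_double:
  fixes f :: "nat \<Rightarrow> 'a::comm_monoid_mult"
  shows "(\<Prod>x<N * 2. f x) = (\<Prod>x<N. f x * f (N + x))"
proof -
  have "(\<Prod>x<N * 2. f x) = prod f {0..<N} * prod f {0 + N..<N + N}"
    using prod.atLeastLessThan_concat[of 0 N "N + N" f] by (simp add: lessThan_atLeast0 mult_2_right)
  also have "prod f {0 + N..<N + N} = (\<Prod>x=0..<N. f (x + N))"
    by (rule prod.shift_bounds_nat_ivl)
  finally show ?thesis
    by (simp add: prod.distrib lessThan_atLeast0 add.commute)
qed

text \<open>The substitution t -> -t, which is the effect of twisting by the sign character
  (-1)^phi.\<close>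

definition sign_twist :: "(int \<Rightarrow>\<^sub>0 int) \<Rightarrow> (int \<Rightarrow>\<^sub>0 int)" where
  "sign_twist = lin_ext (\<lambda>k. Poly_Mapping.single k (if even k then 1 else -1))"

interpretation sign_twist: comm_ring_hom sign_twist
  unfolding sign_twist_def by (rule comm_ring_hom_lin_ext) (auto simp: mult_single)

context meridional_presentation
begin

text \<open>Serves both parts of the quotient: \<open>q = m - 1\<close> with Fox derivatives of the
  relators for the numerator, \<open>q = 1\<close> with s_j - 1 for the denominator.\<close>

lemma twisted_det_dihedral:
  fixes p n :: nat and f :: "'g \<Rightarrow> int \<times> int"
  assumes "prime p" "odd p" and N: "N = p ^ n"
    and e: "bij_betw e {..<N * 2} (carrier (dihedral_group N))"
    and f: "\<And>w. w \<in> F \<Longrightarrow> f (\<epsilon> w) \<in> carrier (dihedral_group N)"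
    and sign: "\<And>w. w \<in> F \<Longrightarrow> snd (f (\<epsilon> w)) = (if even (\<phi> (\<epsilon> w)) then 1 else -1)"
    and keys: "\<And>r s. r < q \<Longrightarrow> s < q \<Longrightarrow> Poly_Mapping.keys (z r s) \<subseteq> F"
  defines "d \<equiv> det (mat q q (\<lambda>(r, s). lin_ext monomial (z r s)))"
  shows "of_int (int p) dvd
      det (mat (N * 2 * q) (N * 2 * q) (\<lambda>(i, j). lin_ext (\<lambda>w. monomial w *
        of_int (regular_representation (dihedral_group N) e (f (\<epsilon> w)) $$ (i mod (N * 2), j mod (N * 2))))
        (z (i div (N * 2)) (j div (N * 2)))))
      - (d * sign_twist d) ^ N"
proof -
  have grp: "group (dihedral_group N)"
    using assms(1) N by (intro group_dihedral_group) (simp add: Suc_leI prime_gt_0_nat)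
  have ek: "e a \<in> carrier (dihedral_group N)" if "a < N * 2" for a
    using e that by (auto simp: bij_betw_def)
  define D where "D x = det (mat q q (\<lambda>(r, s). lin_ext (\<lambda>w. monomial w *
      of_int (dihedral_triangular N (f (\<epsilon> w)) x x)) (z r s)))" for x
  have "of_int (int p) dvd
      det (mat (N * 2 * q) (N * 2 * q) (\<lambda>(i, j). lin_ext (\<lambda>w. monomial w *
        of_int (regular_representation (dihedral_group N) e (f (\<epsilon> w)) $$ (i mod (N * 2), j mod (N * 2))))
        (z (i div (N * 2)) (j div (N * 2)))))
      - (\<Prod>x<N * 2. D x)"
    unfolding D_def
  proof (rule det_blocks_triangularized[where S = F and a = 2
        and \<rho> = "\<lambda>w i j. regular_representation (dihedral_group N) e (f (\<epsilon> w)) $$ (i, j)"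
        and T = "\<lambda>w. dihedral_triangular N (f (\<epsilon> w))"
        and P = "\<lambda>a x. dihedral_basis N (e a) x" and Q = "\<lambda>x a. dihedral_dual N (e a) x"])
    fix w a x assume "w \<in> F" "a < N * 2" "x < N * 2"
    then show "int p dvd
        (\<Sum>y<N * 2. regular_representation (dihedral_group N) e (f (\<epsilon> w)) $$ (a, y) * dihedral_basis N (e y) x)
        - (\<Sum>y<N * 2. dihedral_basis N (e a) y * dihedral_triangular N (f (\<epsilon> w)) y x)"
      using dihedral_mult_basis[OF assms(1) N] f ek
      by (simp add: regular_representation_mult[OF e grp, of _ _ "\<lambda>h. dihedral_basis N h x"])
  next
    fix x y assume "x < N * 2" "y < N * 2"
    then show "(\<Sum>a<N * 2. dihedral_dual N (e a) x * dihedral_basis N (e a) y) = (if x = y then 2 else 0)"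
      using sum.reindex_bij_betw[OF e, of "\<lambda>h. dihedral_dual N h x * dihedral_basis N h y"]
      by (simp add: dihedral_dual_basis)
  next
    show "coprime 2 (int p)"
      using assms(2) by simp
  qed (use keys dihedral_triangular_zero in auto)
  \<comment> \<open>The indices \<open>x\<close> and \<open>N + x\<close> have the same degree but
    differ in the power of the sign, so exactly one of them carries the sign character.\<close>
  moreover have "(\<Prod>x<N * 2. D x) = (\<Prod>x<N. d * sign_twist d)"
    unfolding prod_double
  proof (rule prod.cong)
    fix x assume x: "x \<in> {..<N}"
    have T: "dihedral_triangular N (f (\<epsilon> w)) y y
        = (if even (y div N + y mod N) then 1 else if even (\<phi> (\<epsilon> w)) then 1 else -1)" if "w \<in> F" for w y
      using f[OF that] sign[OF that] by (simp add: dihedral_triangular_diag)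
    have even_case: "D y = d" if "even (y div N + y mod N)" for y
      unfolding D_def d_def
      using that keys by (intro arg_cong[of _ _ det] eq_matI) (auto intro!: lin_ext_cong simp: T subset_iff)
    have odd_case: "D y = sign_twist d" if y: "odd (y div N + y mod N)" for y
    proof -
      have "lin_ext (\<lambda>w. monomial w * of_int (dihedral_triangular N (f (\<epsilon> w)) y y)) (z r s)
          = sign_twist (lin_ext monomial (z r s))" if "r < q" "s < q" for r s
        unfolding sign_twist.hom_lin_ext
      proof (rule lin_ext_cong)
        fix w assume "w \<in> Poly_Mapping.keys (z r s)"
        then have "w \<in> F"
          using keys that by blast
        then show "monomial w * of_int (dihedral_triangular N (f (\<epsilon> w)) y y) = sign_twist (monomial w)"
          using y by (simp add: T sign_twist_def monomial_def single_uminus)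
      qed
      then show ?thesis
        unfolding D_def d_def sign_twist.hom_det[symmetric]
        by (intro arg_cong[of _ _ det] eq_matI) auto
    qed
    show "D x * D (N + x) = d * sign_twist d"
      using even_case odd_case x by (cases "even x") (auto simp: mult.commute)
  qed simp
  ultimately show ?thesis
    by simp
qed

end

section \<open>Laurent polynomials as rational functions\<close>

lemma tvar_nonzero [simp]: "tvar \<noteq> 0"
  by (simp add: tvar_def)

definition laurent_eval :: "(int \<Rightarrow>\<^sub>0 int) \<Rightarrow> int poly fract" where
  "laurent_eval = lin_ext (\<lambda>k. tvar powi k)"

interpretation laurent_eval: comm_ring_hom laurent_eval
  unfolding laurent_eval_def by (rule comm_ring_hom_lin_ext) (auto simp: power_int_add)

definition laurent_of_poly :: "int poly \<Rightarrow> int \<Rightarrow>\<^sub>0 int" where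
  "laurent_of_poly a = (\<Sum>i\<le>degree a. Poly_Mapping.single (int i) (coeff a i))"

lemma lookup_laurent_of_poly:
  "Poly_Mapping.lookup (laurent_of_poly a) k = (if k \<ge> 0 then coeff a (nat k) else 0)"
proof -
  have "Poly_Mapping.lookup (laurent_of_poly a) k = (\<Sum>i\<le>degree a. if int i = k then coeff a i else 0)"
    by (simp add: laurent_of_poly_def lookup_sum lookup_single when_def)
  also have "\<dots> = (if k \<ge> 0 then coeff a (nat k) else 0)"
  proof (cases "k \<ge> 0")
    case True
    then obtain m where k: "k = int m"
      using nonneg_int_cases by blast
    then show ?thesis by (auto simp: coeff_eq_0)
  qed (auto intro!: sum.neutral)
  finally show ?thesis .
qed

lemma to_fract_of_int: "to_fract [:c:] = of_int c"
proof -
  have nat: "to_fract [:int m:] = of_nat m" for m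
  proof (induction m)
    case (Suc m)
    have "[:int (Suc m):] = [:int m:] + 1"
      by (simp add: one_pCons)
    then show ?case
      using Suc by (simp only: to_fract_add to_fract_1) simp
  qed simp
  show ?thesis
  proof (cases c rule: int_cases2)
    case (nonpos m)
    have "[:- int m:] = - [:int m:]" by simp
    then show ?thesis
      using nat[of m] nonpos by (simp only: to_fract_uminus) simp
  qed (simp add: nat)
qed

lemma laurent_eval_single: "laurent_eval (Poly_Mapping.single k c) = of_int c * tvar powi k"
  by (simp add: laurent_eval_def)

lemma laurent_eval_of_poly [simp]: "laurent_eval (laurent_of_poly a) = to_fract a"
proof -
  have monom: "to_fract (monom c i) = of_int c * tvar ^ i" for c i
  proof (induction i)
    case (Suc i)
    have "monom c (Suc i) = [:0, 1:] * monom c i"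
      by (simp add: monom_Suc)
    then show ?case
      using Suc by (simp only: to_fract_mult tvar_def[symmetric]) simp
  qed (simp add: monom_0 to_fract_of_int)
  have "laurent_eval (laurent_of_poly a) = (\<Sum>i\<le>degree a. to_fract (monom (coeff a i) i))"
    by (simp add: laurent_of_poly_def laurent_eval.hom_sum laurent_eval_single monom)
  also have "\<dots> = to_fract (\<Sum>i\<le>degree a. monom (coeff a i) i)"
    by (rule to_fract_sum[symmetric])
  finally show ?thesis
    by (simp add: poly_as_sum_of_monoms)
qed

lemma laurent_of_poly_add: "laurent_of_poly (a + b) = laurent_of_poly a + laurent_of_poly b"
  by (rule poly_mapping_eqI) (simp add: lookup_laurent_of_poly lookup_add)

lemma laurent_of_poly_zero [simp]: "laurent_of_poly 0 = 0"
  by (simp add: laurent_of_poly_def)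

lemma laurent_of_poly_sum: "laurent_of_poly (\<Sum>i\<in>I. a i) = (\<Sum>i\<in>I. laurent_of_poly (a i))"
  by (induction I rule: infinite_finite_induct) (simp_all add: laurent_of_poly_add)

lemma laurent_of_poly_monom: "laurent_of_poly (monom c i) = Poly_Mapping.single (int i) c"
  by (rule poly_mapping_eqI) (auto simp: lookup_laurent_of_poly lookup_single when_def)

text \<open>Every sufficiently high power of t clears the negative exponents; this allows a common
  power for two elements.\<close>

lemma laurent_shift_poly:
  "\<exists>L0. \<forall>L\<ge>L0. \<exists>q. Poly_Mapping.single (int L) 1 * x = laurent_of_poly q"
proof (rule exI, intro allI impI)
  fix L assume L: "(\<Sum>k\<in>Poly_Mapping.keys x. nat \<bar>k\<bar>) \<le> L"
  have nonneg: "int L + k \<ge> 0" if "k \<in> Poly_Mapping.keys x" for k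
  proof -
    have "nat \<bar>k\<bar> \<le> (\<Sum>k\<in>Poly_Mapping.keys x. nat \<bar>k\<bar>)"
      using that by (intro member_le_sum) auto
    then show ?thesis using L by linarith
  qed
  have "Poly_Mapping.single (int L) 1 * x
      = (\<Sum>k\<in>Poly_Mapping.keys x. Poly_Mapping.single (int L + k) (Poly_Mapping.lookup x k))"
    by (subst (1) poly_mapping_sum_single[of x]) (simp add: sum_distrib_left mult_single)
  also have "\<dots> = laurent_of_poly (\<Sum>k\<in>Poly_Mapping.keys x. monom (Poly_Mapping.lookup x k) (nat (int L + k)))"
    unfolding laurent_of_poly_sum laurent_of_poly_monom using nonneg by (intro sum.cong) auto
  finally show "\<exists>q. Poly_Mapping.single (int L) 1 * x = laurent_of_poly q" ..
qed

lemma laurent_eval_eq_0_iff [simp]: "laurent_eval x = 0 \<longleftrightarrow> x = 0"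
proof
  assume "laurent_eval x = 0"
  obtain L q where q: "Poly_Mapping.single (int L) 1 * x = laurent_of_poly q"
    using laurent_shift_poly[of x] by blast
  then have "laurent_eval (Poly_Mapping.single (int L) 1 * x) = to_fract q"
    by simp
  then have "q = 0"
    using \<open>laurent_eval x = 0\<close> by (simp add: laurent_eval.hom_mult)
  then have "Poly_Mapping.single (- int L) 1 * (Poly_Mapping.single (int L) 1 * x) = 0"
    unfolding q by simp
  then show "x = 0"
    by (simp add: mult.assoc[symmetric] mult_single)
qed simp

lemma laurent_eval_eq_iff [simp]: "laurent_eval x = laurent_eval y \<longleftrightarrow> x = y"
  using laurent_eval_eq_0_iff[of "x - y"] by (simp add: laurent_eval.hom_minus)

lemma laurent_of_poly_mult: "laurent_of_poly (a * b) = laurent_of_poly a * laurent_of_poly b"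
  by (subst laurent_eval_eq_iff[symmetric]) (simp add: laurent_eval.hom_mult)

lemma laurent_of_poly_one [simp]: "laurent_of_poly 1 = 1"
  by (subst laurent_eval_eq_iff[symmetric]) simp

interpretation laurent_of_poly: comm_ring_hom laurent_of_poly
  by standard (simp_all add: laurent_of_poly_add laurent_of_poly_mult)

lemma laurent_of_poly_eq_iff [simp]: "laurent_of_poly a = laurent_of_poly b \<longleftrightarrow> a = b"
  by (metis laurent_eval_of_poly to_fract_eq_iff)

lemma laurent_eq_range: "laurent = range laurent_eval"
proof (intro equalityI subsetI)
  fix y assume "y \<in> laurent"
  then obtain a l where "y = to_fract a / tvar ^ l"
    by (auto simp: laurent_def)
  then have "y = laurent_eval (laurent_of_poly a * Poly_Mapping.single (- int l) 1)"
    by (simp add: laurent_eval.hom_mult laurent_eval_single power_int_minus divide_inverse)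
  then show "y \<in> range laurent_eval" by blast
next
  fix y assume "y \<in> range laurent_eval"
  then obtain x where x: "y = laurent_eval x" by blast
  obtain L q where q: "Poly_Mapping.single (int L) 1 * x = laurent_of_poly q"
    using laurent_shift_poly[of x] by blast
  have "tvar ^ L * y = to_fract q"
    using arg_cong[OF q, of laurent_eval] by (simp add: x laurent_eval.hom_mult laurent_eval_single)
  then have "y = to_fract q / tvar ^ L"
    by (simp add: field_simps)
  then show "y \<in> laurent"
    by (auto simp: laurent_def)
qed

lemma laurent_dvd_eval [simp]: "laurent_dvd (laurent_eval x) (laurent_eval y) \<longleftrightarrow> x dvd y"
  by (auto simp: laurent_dvd_def laurent_eq_range dvd_def simp flip: laurent_eval.hom_mult)

text \<open>One of the two factors has constant term zero if \<open>n > 0\<close>; a factor t is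
  split off from it.\<close>

lemma poly_dvd_monom:
  fixes a b :: "int poly"
  assumes "a * b = monom 1 n"
  shows "\<exists>c k. (c = 1 \<or> c = -1) \<and> a = monom c k"
  using assms
proof (induction n arbitrary: a b)
  case 0
  then have "a dvd 1"
    by (metis dvd_triv_left monom_eq_1)
  then obtain c where "a = [:c:]" "c dvd 1"
    by (rule is_unit_polyE)
  moreover from this have "c = 1 \<or> c = -1"
    by auto
  ultimately show ?case
    by (metis monom_0)
next
  case (Suc n)
  have "coeff a 0 * coeff b 0 = coeff (a * b) 0"
    by (simp add: coeff_mult_0)
  then have "coeff a 0 = 0 \<or> coeff b 0 = 0"
    using Suc.prems by simp
  then show ?case
  proof
    assume "coeff a 0 = 0"
    then obtain a' where a': "a = pCons 0 a'"
      by (cases a) auto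
    then have "a' * b = monom 1 n"
      using Suc.prems by (simp add: monom_Suc)
    then obtain c k where "c = 1 \<or> c = -1" "a' = monom c k"
      using Suc.IH by blast
    then show ?case
      using a' by (auto simp: monom_Suc[symmetric])
  next
    assume "coeff b 0 = 0"
    then obtain b' where "b = pCons 0 b'"
      by (cases b) auto
    then have "a * b' = monom 1 n"
      using Suc.prems by (simp add: monom_Suc)
    then show ?case
      using Suc.IH by blast
  qed
qed

text \<open>Once negative exponents are cleared, a unit and its inverse become integral polynomials
  whose product is a power of t.\<close>

lemma laurent_unit:
  assumes "u dvd (1 :: int \<Rightarrow>\<^sub>0 int)"
  obtains c k where "c = 1 \<or> c = -1" "u = Poly_Mapping.single k c"
proof -
  obtain v where uv: "u * v = 1"
    using assms by (auto simp: dvd_def)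
  obtain L a where a: "Poly_Mapping.single (int L) 1 * u = laurent_of_poly a"
    using laurent_shift_poly[of u] by blast
  obtain M b where b: "Poly_Mapping.single (int M) 1 * v = laurent_of_poly b"
    using laurent_shift_poly[of v] by blast
  have "laurent_of_poly (a * b)
      = Poly_Mapping.single (int L) 1 * Poly_Mapping.single (int M) 1 * (u * v)"
    unfolding laurent_of_poly_mult a[symmetric] b[symmetric] by (simp add: mult_ac)
  also have "\<dots> = laurent_of_poly (monom 1 (L + M))"
    by (simp add: uv mult_single laurent_of_poly_monom)
  finally have "a * b = monom 1 (L + M)"
    by simp
  then obtain c k where c: "c = 1 \<or> c = -1" "a = monom c k"
    using poly_dvd_monom by blast
  have "u = Poly_Mapping.single (- int L) 1 * (Poly_Mapping.single (int L) 1 * u)"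
    by (simp add: mult.assoc[symmetric] mult_single)
  also have "\<dots> = Poly_Mapping.single (int k - int L) c"
    unfolding a c by (simp add: laurent_of_poly_monom mult_single)
  finally show thesis
    using c that by blast
qed

section \<open>Congruences modulo p between Laurent polynomials\<close>

lemma of_int_eq_single: "(of_int c :: int \<Rightarrow>\<^sub>0 int) = Poly_Mapping.single 0 c"
  by (simp flip: single_of_int)

lemma lookup_of_int_mult:
  "Poly_Mapping.lookup (of_int c * x :: int \<Rightarrow>\<^sub>0 int) k = c * Poly_Mapping.lookup x k"
proof -
  have "of_int c * x = Poly_Mapping.map ((*) c) x"
    by (simp only: mult_map_scale_conv_mult of_int_eq_single)
  then show ?thesis
    by (simp add: Poly_Mapping.map.rep_eq when_def)
qed

lemma poly_cong_of_dvd: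
  assumes "of_int (int p) dvd laurent_of_poly a - laurent_of_poly b"
  shows "poly_cong p a b"
proof -
  obtain x where x: "laurent_of_poly (a - b) = of_int (int p) * x"
    using assms by (auto simp: dvd_def laurent_of_poly.hom_minus)
  have "coeff a i - coeff b i = int p * Poly_Mapping.lookup x (int i)" for i
    using arg_cong[OF x, of "\<lambda>y. Poly_Mapping.lookup y (int i)"]
    by (simp add: lookup_of_int_mult lookup_laurent_of_poly del: of_int_of_nat_eq)
  then show ?thesis
    by (auto simp: poly_cong_def cong_iff_dvd_diff)
qed

lemma sign_twist_of_poly:
  "sign_twist (laurent_of_poly a) = laurent_of_poly (pcompose a [:0, -1:])"
proof -
  have "sign_twist (Poly_Mapping.single (int i) c) = Poly_Mapping.single (int i) ((-1) ^ i * c)" for i c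
  proof -
    have "sign_twist (Poly_Mapping.single (int i) c)
        = Poly_Mapping.single 0 c * Poly_Mapping.single (int i) (if even (int i) then 1 else -1)"
      by (simp only: sign_twist_def lin_ext_single of_int_eq_single)
    also have "\<dots> = Poly_Mapping.single (int i) ((-1) ^ i * c)"
      unfolding mult_single by simp
    finally show ?thesis .
  qed
  then show ?thesis
    by (simp add: laurent_of_poly_def sign_twist.hom_sum degree_pcompose coeff_pcompose_linear)
qed

lemma tvar_linear: "to_fract [:-1, 1:] = tvar - 1" "to_fract [:1, 1:] = tvar + 1"
proof -
  have "[:-1, 1:] = [:0, 1:] - (1 :: int poly)" "[:1, 1:] = [:0, 1:] + (1 :: int poly)"
    by (simp_all add: one_pCons)
  then show "to_fract [:-1, 1:] = tvar - 1" "to_fract [:1, 1:] = tvar + 1"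
    unfolding tvar_def by (simp_all only: to_fract_diff to_fract_add to_fract_1)
qed

lemma dvd_antisym_unit:
  fixes x y :: "'a::idom"
  assumes "x dvd y" "y dvd x"
  obtains u where "u dvd 1" "y = u * x"
proof (cases "x = 0")
  case True
  then show thesis
    using assms(1) that[of 1] by simp
next
  case False
  obtain u where u: "y = x * u"
    using assms(1) by (rule dvdE)
  obtain v where "x = y * v"
    using assms(2) by (rule dvdE)
  with u have "x * (u * v) = x * 1"
    by (simp add: mult.assoc[symmetric])
  then have "u * v = 1"
    using False mult_left_cancel by blast
  then show thesis
    using that[of u] u by (metis dvd_triv_left mult.commute)
qed

text \<open>A common power of t makes \<open>D\<close> and \<open>E\<close> polynomials without
  changing their quotient. The monomials in the hypotheses supply the unit allowed by
  \<open>fract_cong\<close>.\<close>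

lemma fract_cong_of_laurent:
  fixes D E :: "int \<Rightarrow>\<^sub>0 int"
  assumes "prime p"
    and D: "of_int (int p) dvd D - Poly_Mapping.single K s * laurent_of_poly c"
    and E: "of_int (int p) dvd E - Poly_Mapping.single 0 s' * laurent_of_poly d"
    and s: "s = 1 \<or> s = -1" "s' = 1 \<or> s' = -1"
    and "\<not> poly_cong p d 0"
  shows "fract_cong p (laurent_eval D / laurent_eval E) (to_fract c / to_fract d)"
proof -
  let ?d = "of_int (int p) :: int \<Rightarrow>\<^sub>0 int"
  obtain L1 where L1: "\<forall>L\<ge>L1. \<exists>q. Poly_Mapping.single (int L) 1 * D = laurent_of_poly q"
    using laurent_shift_poly[of D] by blast
  obtain L2 where L2: "\<forall>L\<ge>L2. \<exists>q. Poly_Mapping.single (int L) 1 * E = laurent_of_poly q"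
    using laurent_shift_poly[of E] by blast
  define L where "L = max L1 L2"
  define T where "T k = (Poly_Mapping.single k 1 :: int \<Rightarrow>\<^sub>0 int)" for k
  have T_mult: "T k * T l = T (k + l)" "T k * (T l * x) = T (k + l) * x" for k l x
    by (simp_all add: T_def mult_single mult.assoc[symmetric])
  have single: "Poly_Mapping.single k (c :: int) = T k * of_int c" for k c
    by (simp add: T_def of_int_eq_single mult_single)
  obtain a where a: "T (int L) * D = laurent_of_poly a"
    using L1[rule_format, of L] by (auto simp: L_def T_def)
  obtain b where b: "T (int L) * E = laurent_of_poly b"
    using L2[rule_format, of L] by (auto simp: L_def T_def)
  have "laurent_eval D / laurent_eval E = to_fract a / to_fract b"
  proof -
    have "laurent_eval (T (int L)) \<noteq> 0"
      by (simp add: T_def laurent_eval_single)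
    then show ?thesis
      unfolding laurent_eval_of_poly[symmetric] a[symmetric] b[symmetric] laurent_eval.hom_mult
      by simp
  qed
  \<comment> \<open>If \<open>p\<close> divided \<open>b\<close>, it would divide \<open>E\<close>,
    and then \<open>d\<close>, because t and \<open>s'\<close> are units.\<close>
  moreover have "\<not> poly_cong p b 0"
  proof
    assume "poly_cong p b 0"
    then have "\<forall>i. int p dvd coeff b i"
      by (simp add: poly_cong_def cong_0_iff)
    then have "[:int p:] dvd b"
      by (simp add: const_poly_dvd_iff)
    then obtain q where "b = [:int p:] * q"
      by (auto simp: dvd_def)
    moreover have "laurent_of_poly [:int p:] = ?d"
      using laurent_of_poly_monom[of "int p" 0] by (simp add: monom_0 of_int_eq_single del: of_int_of_nat_eq)
    ultimately have "?d dvd laurent_of_poly b"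
      by (simp only: laurent_of_poly_mult dvd_triv_left)
    then have "?d dvd T (- int L) * (T (int L) * E)"
      unfolding b by (rule dvd_mult)
    then have "?d dvd E"
      by (simp add: T_mult) (simp add: T_def)
    with E have "?d dvd of_int s' * laurent_of_poly d"
      unfolding single by (metis T_def add_0 diff_add_cancel dvd_diff_commute dvd_add_right_iff mult_1 single_one)
    then have "?d dvd laurent_of_poly d"
      using s(2) by auto
    then have "?d dvd laurent_of_poly d - laurent_of_poly 0"
      by simp
    then show False
      using poly_cong_of_dvd assms(6) by blast
  qed
  \<comment> \<open>The exponent \<open>K\<close> may be negative, so its negative part goes to the
    left and its positive part to the right.\<close>
  moreover have "poly_cong p (monom 1 (nat (- K)) * (a * d)) (monom (s * s') (nat K) * (c * b))"
  proof (rule poly_cong_of_dvd)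
    let ?c = "laurent_of_poly c" and ?e = "laurent_of_poly d"
    have K: "int (nat (- K)) + K = int (nat K)"
      by simp
    have ss: "of_int s' * of_int s' = (1 :: int \<Rightarrow>\<^sub>0 int)"
      using s(2) by auto
    obtain x where x: "D = T K * of_int s * ?c + ?d * x"
      using D unfolding single by (auto simp: dvd_def algebra_simps)
    obtain y where y: "E = of_int s' * ?e + ?d * y"
      using E unfolding single by (auto simp: dvd_def algebra_simps T_def)
    have "laurent_of_poly (monom 1 (nat (- K)) * (a * d))
        = T (int (nat (- K))) * T (int L) * D * ?e"
      unfolding laurent_of_poly_mult laurent_of_poly_monom a[symmetric] single
      by (simp add: mult_ac)
    also have "\<dots> = T (int (nat (- K))) * T K * T (int L) * of_int s * ?c * ?e
        + ?d * (T (int (nat (- K))) * T (int L) * x * ?e)"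
      unfolding x by (simp only: distrib_left distrib_right mult_ac)
    also have "T (int (nat (- K))) * T K = T (int (nat K))"
      unfolding T_mult K by simp
    finally have 1: "laurent_of_poly (monom 1 (nat (- K)) * (a * d))
        = T (int (nat K)) * T (int L) * of_int s * ?c * ?e
        + ?d * (T (int (nat (- K))) * T (int L) * x * ?e)" .
    have "laurent_of_poly (monom (s * s') (nat K) * (c * b))
        = T (int (nat K)) * T (int L) * of_int s * of_int s' * ?c * E"
      unfolding laurent_of_poly_mult laurent_of_poly_monom b[symmetric] single
      by (simp add: mult_ac)
    also have "\<dots> = (of_int s' * of_int s') * (T (int (nat K)) * T (int L) * of_int s * ?c * ?e)
        + ?d * (T (int (nat K)) * T (int L) * of_int s * of_int s' * ?c * y)"
      unfolding y by (simp only: distrib_left distrib_right mult_ac)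
    finally have 2: "laurent_of_poly (monom (s * s') (nat K) * (c * b))
        = T (int (nat K)) * T (int L) * of_int s * ?c * ?e
        + ?d * (T (int (nat K)) * T (int L) * of_int s * of_int s' * ?c * y)"
      unfolding ss mult_1 .
    show "?d dvd laurent_of_poly (monom 1 (nat (- K)) * (a * d)) - laurent_of_poly (monom (s * s') (nat K) * (c * b))"
      unfolding 1 2 add_diff_add diff_self add_0 right_diff_distrib[symmetric] by (rule dvd_triv_left)
  qed
  moreover have "\<not> int p dvd s * s'"
    using s prime_gt_1_nat[OF assms(1)] by auto
  ultimately show ?thesis
    unfolding fract_cong_def using assms(6) by blast
qed

section \<open>Knot groups\<close>

context meridional_presentation
begin

lemma Phi_entry:
  assumes "a < k" "c < k"
  shows "Phi \<phi> k \<rho> \<epsilon> z $$ (a, c)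
    = laurent_eval (lin_ext (\<lambda>w. monomial w * of_int (\<rho> (\<epsilon> w) $$ (a, c))) z)"
  using assms unfolding laurent_eval.hom_lin_ext
  by (simp add: Phi_def lin_ext_def laurent_eval.hom_mult laurent_eval.hom_of_int monomial_def laurent_eval_single)

lemma fox_minor_eq:
  assumes "j < m" "k > 0"
  shows "fox_minor \<phi> k \<rho> m \<epsilon> rel j = laurent_eval (det (mat (k * (m - 1)) (k * (m - 1)) (\<lambda>(a, c).
    lin_ext (\<lambda>w. monomial w * of_int (\<rho> (\<epsilon> w) $$ (a mod k, c mod k)))
      (fox (skip j (c div k)) (rel (a div k))))))"
proof -
  let ?n = "k * (m - 1)"
  let ?M = "mat ?n ?n (\<lambda>(a, c).
    lin_ext (\<lambda>w. monomial w * of_int (\<rho> (\<epsilon> w) $$ (a mod k, c mod k)))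
      (fox (skip j (c div k)) (rel (a div k))))"
  have n: "k * m = ?n + k"
    using m_pos by (cases m) auto
  have "remove_block_col k j (fox_matrix \<phi> k \<rho> m \<epsilon> rel) = map_mat laurent_eval ?M"
  proof (rule eq_matI)
    fix a c assume "a < dim_row (map_mat laurent_eval ?M)" "c < dim_col (map_mat laurent_eval ?M)"
    then have ac: "a < ?n" "c < ?n" by simp_all
    \<comment> \<open>Shifting columns by \<open>k\<close> past the removed block is
      \<open>skip j\<close> on block numbers and leaves the inner position alone.\<close>
    have "c < k * j \<longleftrightarrow> c div k < j"
      using assms(2) by (simp add: div_less_iff_less_mult mult.commute)
    then have "(if c < k * j then c else c + k) div k = skip j (c div k)"
      "(if c < k * j then c else c + k) mod k = c mod k"
      "(if c < k * j then c else c + k) < k * m"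
      using ac assms(2) by (auto simp: skip_def n)
    then show "remove_block_col k j (fox_matrix \<phi> k \<rho> m \<epsilon> rel) $$ (a, c) = map_mat laurent_eval ?M $$ (a, c)"
      using ac assms(2) by (simp add: remove_block_col_def fox_matrix_def n Phi_entry)
  qed (simp_all add: remove_block_col_def fox_matrix_def n)
  then show ?thesis
    by (simp add: fox_minor_def laurent_eval.hom_det)
qed

lemma fox_minor_trivial:
  assumes "j < m"
  shows "fox_minor \<phi> 1 (\<lambda>_. 1\<^sub>m 1) m \<epsilon> rel j = laurent_eval (alex_minor j)"
proof -
  have "0 < (1 :: nat)" by simp
  show ?thesis
    unfolding fox_minor_eq[OF assms \<open>0 < 1\<close>] alex_minor_def alex_def by simp
qed

text \<open>The minors of one presentation divide each other, so each of them is a greatest common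
  divisor of all.\<close>

lemma alexander_polynomial_minor:
  assumes "let minor = fox_minor \<phi> 1 (\<lambda>_. 1\<^sub>m 1) m \<epsilon> rel in
      (\<forall>j<m. laurent_dvd (to_fract \<Delta>) (minor j)) \<and>
      (\<forall>d\<in>laurent. (\<forall>j<m. laurent_dvd d (minor j)) \<longrightarrow> laurent_dvd d (to_fract \<Delta>))"
    and "j < m"
  shows "laurent_of_poly \<Delta> dvd alex_minor j" "alex_minor j dvd laurent_of_poly \<Delta>"
proof -
  note gcd = assms(1)[unfolded Let_def]
  have eval: "to_fract \<Delta> = laurent_eval (laurent_of_poly \<Delta>)"
    by simp
  show "laurent_of_poly \<Delta> dvd alex_minor j"
    using gcd assms(2) by (metis eval fox_minor_trivial laurent_dvd_eval)
  have "alex_minor j dvd alex_minor i" if "i < m" for i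
    by (rule alex_minor_dvd[OF meridional_presentation_axioms meridional_presentation_axioms assms(2) that])
  then have "\<forall>i<m. laurent_dvd (laurent_eval (alex_minor j)) (fox_minor \<phi> 1 (\<lambda>_. 1\<^sub>m 1) m \<epsilon> rel i)"
    by (auto simp only: fox_minor_trivial laurent_dvd_eval)
  then have "laurent_dvd (laurent_eval (alex_minor j)) (to_fract \<Delta>)"
    using gcd by (simp add: laurent_eq_range)
  then show "alex_minor j dvd laurent_of_poly \<Delta>"
    by (simp only: eval laurent_dvd_eval)
qed

text \<open>
  The Wirtinger relations make all meridians conjugate; they cannot all go to rotations, so they
  all go to reflections.
\<close>

lemma dihedral_sign:
  assumes "N \<ge> 1" and f: "f \<in> epi G (dihedral_group N)"
    and wirtinger: "\<And>i. i < m - 1 \<Longrightarrow> \<exists>h<m. rel i = gen h + gen i - gen h - gen (i + 1) \<or>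
        rel i = - gen h + gen i + gen h - gen (i + 1)"
    and w: "w \<in> F"
  shows "snd (f (\<epsilon> w)) = (if even (\<phi> (\<epsilon> w)) then 1 else -1)"
proof -
  define \<sigma> where "\<sigma> w = snd (f (\<epsilon> w))" for w
  have hom: "f \<in> hom G (dihedral_group N)" and surj: "f ` carrier G = carrier (dihedral_group N)"
    using f by (simp_all add: epi_def)
  have closed: "f (\<epsilon> w) \<in> carrier (dihedral_group N)" if "w \<in> F" for w
    using hom that by (auto simp: hom_def)
  have add: "\<sigma> (u + v) = \<sigma> u * \<sigma> v" if "u \<in> F" "v \<in> F" for u v
    using hom_mult[OF hom, of "\<epsilon> u" "\<epsilon> v"] that
    by (simp add: \<sigma>_def dihedral_group_def case_prod_unfold)
  have pm_one: "\<sigma> u = 1 \<or> \<sigma> u = -1" if "u \<in> F" for u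
    using closed[OF that] by (auto simp: \<sigma>_def dihedral_group_def)
  have zero: "\<sigma> 0 = 1"
    using add[of 0 0] pm_one[of 0] by auto
  have uminus: "\<sigma> (- u) = \<sigma> u" if "u \<in> F" for u
    using add[of u "- u"] pm_one[OF that] pm_one[of "- u"] zero that by auto
  have \<sigma>_one: "\<sigma> u = 1" if "\<epsilon> u = \<one>\<^bsub>G\<^esub>" for u
    using zero that by (simp add: \<sigma>_def)
  have "\<sigma> (gen (Suc i)) = \<sigma> (gen i)" if i: "Suc i < m" for i
  proof -
    have i': "i < m - 1" using i by simp
    have diff: "\<sigma> (u - v) = \<sigma> u * \<sigma> v" if "u \<in> F" "v \<in> F" for u v
      using add[of u "- v"] that uminus by simp
    have diff_F: "u - v \<in> F" if "u \<in> F" "v \<in> F" for u v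
      using add_free_group[of u m "- v"] that by simp
    obtain h where h: "h < m" "rel i = gen h + gen i - gen h - gen (i + 1) \<or>
        rel i = - gen h + gen i + gen h - gen (i + 1)"
      using wirtinger[OF i'] by blast
    \<comment> \<open>The values of \<open>\<sigma>\<close> commute and are their own inverses, so
      both forms of the relation give the same product, in which \<open>gen h\<close> occurs
      twice.\<close>
    then have "\<sigma> (rel i) = \<sigma> (gen h) * \<sigma> (gen i) * \<sigma> (gen h) * \<sigma> (gen (Suc i))"
      using i by (elim disjE) (simp_all add: diff diff_F add uminus)
    moreover have "\<sigma> (rel i) = 1"
      by (rule \<sigma>_one[OF eps_rel[OF i']])
    ultimately show ?thesis
      using pm_one[of "gen h"] pm_one[of "gen i"] pm_one[of "gen (Suc i)"] h(1) i by auto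
  qed
  then have gen_eq: "\<sigma> (gen i) = \<sigma> (gen 0)" if "i < m" for i
    using that by (induction i) simp_all
  have "\<sigma> (gen 0) = -1"
  proof (rule ccontr)
    assume "\<sigma> (gen 0) \<noteq> -1"
    then have gen: "\<sigma> (gen i) = 1" if "i < m" for i
      using gen_eq[OF that] pm_one[of "gen 0"] m_pos by simp
    have "(0, -1) \<in> carrier (dihedral_group N)"
      using assms(1) by (simp add: dihedral_group_def)
    then obtain u where u: "u \<in> F" "f (\<epsilon> u) = (0, -1)"
      using surj eps_surj by (metis imageE)
    have "\<sigma> u = 1"
      using u(1) by (induction rule: free_group_induct) (simp_all add: zero add gen uminus)
    then show False
      using u(2) by (simp add: \<sigma>_def)
  qed
  then have gen: "\<sigma> (gen i) = -1" if "i < m" for i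
    using gen_eq[OF that] by simp
  have gen_inv: "\<phi> (inv\<^bsub>G\<^esub> \<epsilon> (gen i)) = -1" if "i < m" for i
  proof -
    have "\<phi> (\<epsilon> (gen i + - gen i)) = \<phi> (\<epsilon> (gen i)) + \<phi> (\<epsilon> (- gen i))"
      using that by (simp add: group.inv_closed[OF group_G] del: add_uminus_conv_diff right_minus)
    then show ?thesis
      using that phi_gen[OF that] by simp
  qed
  have "\<sigma> w = (if even (\<phi> (\<epsilon> w)) then 1 else -1)"
    using w
  proof (induction rule: free_group_induct)
    case (gen i w)
    then show ?case
      using \<open>\<And>i. i < m \<Longrightarrow> \<sigma> (gen i) = -1\<close> by (simp add: add phi_gen)
  next
    case (inv i w)
    then have "\<phi> (\<epsilon> (- gen i + w)) = -1 + \<phi> (\<epsilon> w)"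
      using group_G by (simp add: gen_inv group.inv_closed)
    then show ?case
      using inv \<open>\<And>i. i < m \<Longrightarrow> \<sigma> (gen i) = -1\<close> by (simp add: add uminus)
  qed (simp add: zero)
  then show ?thesis
    by (simp add: \<sigma>_def)
qed

end

lemma wirtinger_presentation_meridional:
  assumes "b \<in> knot_exterior \<gamma> r" "knot_abelianization \<gamma> r b \<phi>"
    and "wirtinger_presentation \<gamma> r b m \<epsilon> rel"
  shows "meridional_presentation (knot_group \<gamma> r b) \<phi> m \<epsilon> rel"
proof (rule meridional_presentation.intro)
  show "group (knot_group \<gamma> r b)"
    unfolding knot_group_def by (rule group_fundamental_group) fact
qed (use assms(2,3) in \<open>auto simp: knot_abelianization_def wirtinger_presentation_def epi_def\<close>)

theorem corollary1p2:
  fixes p n :: nat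
    and \<gamma> :: "real \<Rightarrow> real^4" and r :: real and b :: "real^4"
    and \<phi> :: "(real \<Rightarrow> real^4) set \<Rightarrow> int"
    and \<Delta> :: "int poly"
    and e :: "nat \<Rightarrow> int \<times> int"
    and f :: "(real \<Rightarrow> real^4) set \<Rightarrow> int \<times> int"
    and \<tau> :: "int poly fract"
  assumes "prime p" and "odd p" and "n \<ge> 1"
    and "bij_betw e {..<2 * p ^ n} (carrier (dihedral_group (p ^ n)))"
    and "oriented_knot \<gamma>" and "tubular_radius \<gamma> r" and "b \<in> knot_exterior \<gamma> r"
    and "knot_abelianization \<gamma> r b \<phi>"
    and "is_alexander_polynomial \<gamma> r b \<phi> \<Delta>"
    and "f \<in> epi (knot_group \<gamma> r b) (dihedral_group (p ^ n))"
    and "is_twisted_alexander_polynomial \<gamma> r b \<phi> (2 * p ^ n)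
           (regular_representation (dihedral_group (p ^ n)) e \<circ> f) \<tau>"
  shows "fract_cong p \<tau>
           ((to_fract \<Delta> / (tvar - 1) * (to_fract (pcompose \<Delta> [:0, -1:]) / (tvar + 1))) ^ (p ^ n))"
proof -
  define N where "N = p ^ n"
  have N0: "N > 0"
    using prime_gt_0_nat[OF assms(1)] by (simp add: N_def)
  let ?R = "\<lambda>g. regular_representation (dihedral_group N) e (f g)"
  let ?d = "of_int (int p) :: int \<Rightarrow>\<^sub>0 int"
  obtain m' \<epsilon>' rel' where w': "wirtinger_presentation \<gamma> r b m' \<epsilon>' rel'"
    and gcd: "let minor = fox_minor \<phi> 1 (\<lambda>_. 1\<^sub>m 1) m' \<epsilon>' rel' in
      (\<forall>j<m'. laurent_dvd (to_fract \<Delta>) (minor j)) \<and>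
      (\<forall>d\<in>laurent. (\<forall>j<m'. laurent_dvd d (minor j)) \<longrightarrow> laurent_dvd d (to_fract \<Delta>))"
    using assms(9) unfolding is_alexander_polynomial_def by blast
  obtain m \<epsilon> rel j where w: "wirtinger_presentation \<gamma> r b m \<epsilon> rel" and j: "j < m"
    and \<tau>: "\<tau> = fox_minor \<phi> (N * 2) ?R m \<epsilon> rel j / det (Phi \<phi> (N * 2) ?R \<epsilon> (Poly_Mapping.single (gen j) 1 - 1))"
    using assms(11) unfolding is_twisted_alexander_polynomial_def N_def comp_def
    by (auto simp: mult.commute)
  interpret P': meridional_presentation "knot_group \<gamma> r b" \<phi> m' \<epsilon>' rel'
    by (rule wirtinger_presentation_meridional[OF assms(7,8) w'])
  interpret P: meridional_presentation "knot_group \<gamma> r b" \<phi> m \<epsilon> rel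
    by (rule wirtinger_presentation_meridional[OF assms(7,8) w])
  have m': "0 < m'"
    using P'.m_pos by simp
  \<comment> \<open>\<open>\<Delta>\<close> is computed from the presentation of \<open>P'\<close>
    and \<open>\<tau>\<close> from that of \<open>P\<close>; this minor links them.\<close>
  define \<delta> where "\<delta> = P.alex_minor j"
  have "laurent_of_poly \<Delta> dvd \<delta>" "\<delta> dvd laurent_of_poly \<Delta>"
    using P'.alexander_polynomial_minor[OF gcd m']
      alex_minor_dvd[OF P'.meridional_presentation_axioms P.meridional_presentation_axioms m' j]
      alex_minor_dvd[OF P.meridional_presentation_axioms P'.meridional_presentation_axioms j m']
    unfolding \<delta>_def by (blast intro: dvd_trans)+
  then obtain u where "u dvd 1" and \<delta>: "\<delta> = u * laurent_of_poly \<Delta>"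
    by (rule dvd_antisym_unit)
  then obtain c k where c: "c = 1 \<or> c = -1" and u: "u = Poly_Mapping.single k c"
    using laurent_unit by blast
  define \<Delta>' where "\<Delta>' = pcompose \<Delta> [:0, -1:]"
  \<comment> \<open>The sign in t^k -> (-t)^k. The coefficient \<open>c\<close> of \<open>u\<close>
    is squared in \<open>u * sign_twist u\<close> and disappears.\<close>
  define c' :: int where "c' = (if even k then 1 else -1)"
  have twist_u: "sign_twist u = Poly_Mapping.single k c'  * of_int c"
    by (simp add: u sign_twist_def c'_def mult.commute)
  have "\<delta> * sign_twist \<delta> = Poly_Mapping.single (k + k) c' * laurent_of_poly (\<Delta> * \<Delta>')"
  proof -
    have "u * sign_twist u = Poly_Mapping.single (k + k) c'"
      unfolding twist_u unfolding u of_int_eq_single mult_single using c by auto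
    then show ?thesis
      unfolding \<delta> by (simp add: sign_twist.hom_mult sign_twist_of_poly \<Delta>'_def laurent_of_poly_mult mult_ac)
  qed
  then have \<delta>_power: "(\<delta> * sign_twist \<delta>) ^ N
      = Poly_Mapping.single (k + k) c' ^ N * laurent_of_poly ((\<Delta> * \<Delta>') ^ N)"
    by (simp only: laurent_of_poly.hom_power power_mult_distrib[of "Poly_Mapping.single _ _"])
  have single_power: "Poly_Mapping.single l x ^ i = Poly_Mapping.single (int i * l) (x ^ i)"
    for l x :: int and i
    by (induction i) (simp_all add: mult_single algebra_simps)
  have e: "bij_betw e {..<N * 2} (carrier (dihedral_group N))"
    using assms(4) by (simp add: N_def mult.commute)
  have f: "f (\<epsilon> w) \<in> carrier (dihedral_group N)" if "w \<in> P.F" for w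
    using assms(10) P.eps_closed[OF that] by (auto simp: epi_def hom_def N_def)
  have sign: "snd (f (\<epsilon> w)) = (if even (\<phi> (\<epsilon> w)) then 1 else -1)" if "w \<in> P.F" for w
    using assms(10) w N0 that unfolding N_def
    by (intro P.dihedral_sign) (auto simp: wirtinger_presentation_def)
  define D where "D = det (mat (N * 2 * (m - 1)) (N * 2 * (m - 1)) (\<lambda>(a, c).
    lin_ext (\<lambda>w. P.monomial w * of_int (?R (\<epsilon> w) $$ (a mod (N * 2), c mod (N * 2))))
      (fox (skip j (c div (N * 2))) (rel (a div (N * 2))))))"
  have "?d dvd D - (\<delta> * sign_twist \<delta>) ^ N"
    unfolding D_def \<delta>_def P.alex_minor_def P.alex_def
    by (rule P.twisted_det_dihedral[OF assms(1,2) N_def e f sign]) (use keys_fox P.rel_F in auto)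
  then have D: "?d dvd D - Poly_Mapping.single (int N * (k + k)) (c' ^ N) * laurent_of_poly ((\<Delta> * \<Delta>') ^ N)"
    unfolding \<delta>_power single_power .
  define z where "z = Poly_Mapping.single (gen j) (1::int) - 1"
  define E where "E = det (mat (N * 2 * 1) (N * 2 * 1) (\<lambda>(a, c).
    lin_ext (\<lambda>w. P.monomial w * of_int (?R (\<epsilon> w) $$ (a mod (N * 2), c mod (N * 2)))) z))"
  define g where "g = lin_ext P.monomial z"
  have g: "g = laurent_var - 1"
    using j by (simp add: g_def z_def lin_ext_diff lin_ext_one P.monomial_gen)
  have "?d dvd E - (det (mat 1 1 (\<lambda>(r, s). lin_ext P.monomial z))
      * sign_twist (det (mat 1 1 (\<lambda>(r, s). lin_ext P.monomial z)))) ^ N"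
    unfolding E_def
  proof (rule P.twisted_det_dihedral[OF assms(1,2) N_def e f sign])
    show "Poly_Mapping.keys z \<subseteq> P.F"
      using keys_diff[of "Poly_Mapping.single (gen j) (1::int)" 1] j by (auto simp: z_def)
  qed
  moreover have "det (mat 1 1 (\<lambda>(r, s). lin_ext P.monomial z)) = g"
    by (subst det_single) (simp_all add: g_def)
  \<comment> \<open>The constant comes from (t - 1)(-t - 1) = -(t - 1)(t + 1).\<close>
  moreover have "(g * sign_twist g) ^ N = Poly_Mapping.single 0 ((-1) ^ N) * laurent_of_poly (([:-1, 1:] * [:1, 1:]) ^ N)"
  proof -
    have "laurent_eval laurent_var = tvar"
      by (simp add: laurent_eval_single)
    then have "laurent_of_poly [:-1, 1:] = laurent_var - 1" "laurent_of_poly [:1, 1:] = laurent_var + 1"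
      unfolding laurent_eval_eq_iff[symmetric] laurent_eval_of_poly tvar_linear
      by (simp_all add: laurent_eval.hom_minus laurent_eval.hom_add)
    then have q: "laurent_of_poly ([:-1, 1:] * [:1, 1:]) = (laurent_var - 1) * (laurent_var + 1)"
      by (simp only: laurent_of_poly_mult)
    have "sign_twist laurent_var = - laurent_var"
      by (simp add: sign_twist_def single_uminus)
    then have "sign_twist g = - laurent_var - 1"
      by (simp only: g sign_twist.hom_minus sign_twist.hom_one)
    then have "g * sign_twist g = - 1 * ((laurent_var - 1) * (laurent_var + 1))"
      by (simp only: g) (simp add: algebra_simps)
    moreover have "Poly_Mapping.single 0 ((-1) ^ N) = (-1 :: int \<Rightarrow>\<^sub>0 int) ^ N"
      by (simp flip: of_int_eq_single)
    ultimately show ?thesis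
      by (simp only: laurent_of_poly.hom_power q power_mult_distrib[of "-1"])
  qed
  ultimately have E: "?d dvd E - Poly_Mapping.single 0 ((-1) ^ N) * laurent_of_poly (([:-1, 1:] * [:1, 1:]) ^ N)"
    by simp
  have "\<tau> = laurent_eval D / laurent_eval E"
  proof -
    have "fox_minor \<phi> (N * 2) ?R m \<epsilon> rel j = laurent_eval D"
      unfolding D_def using N0 j by (intro P.fox_minor_eq) auto
    moreover have "Phi \<phi> (N * 2) ?R \<epsilon> z = map_mat laurent_eval (mat (N * 2 * 1) (N * 2 * 1) (\<lambda>(a, c).
        lin_ext (\<lambda>w. P.monomial w * of_int (?R (\<epsilon> w) $$ (a mod (N * 2), c mod (N * 2)))) z))"
      by (rule eq_matI) (simp_all add: P.Phi_entry, simp_all add: Phi_def)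
    ultimately show ?thesis
      unfolding \<tau> E_def z_def[symmetric] by (simp only: laurent_eval.hom_det)
  qed
  moreover have "fract_cong p (laurent_eval D / laurent_eval E)
      (to_fract ((\<Delta> * \<Delta>') ^ N) / to_fract (([:-1, 1:] * [:1, 1:]) ^ N))"
  proof (rule fract_cong_of_laurent[OF assms(1) D E])
    let ?q = "([:-1, 1:] * [:1, 1:]) ^ N :: int poly"
    \<comment> \<open>A monic denominator remains nonzero modulo every prime.\<close>
    have "lead_coeff ?q = 1"
      unfolding lead_coeff_power lead_coeff_mult by simp
    then show "\<not> poly_cong p ?q 0"
      using prime_gt_1_nat[OF assms(1)] unfolding poly_cong_def
      by (metis coeff_0 cong_0_iff int_dvd_int_iff nat_dvd_1_iff_1 of_nat_1 order_less_irrefl)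
    show "c' ^ N = 1 \<or> c' ^ N = - 1" "(-1) ^ N = (1 :: int) \<or> (-1) ^ N = (-1 :: int)"
      by (auto simp: c'_def minus_one_power_iff)
  qed
  moreover have "to_fract ((\<Delta> * \<Delta>') ^ N) / to_fract (([:-1, 1:] * [:1, 1:]) ^ N)
      = (to_fract \<Delta> / (tvar - 1) * (to_fract \<Delta>' / (tvar + 1))) ^ N"
  proof -
    have "to_fract (x ^ N) = to_fract x ^ N" for x :: "int poly"
      by (induction N) simp_all
    then show ?thesis
      by (simp only: to_fract_mult tvar_linear power_divide times_divide_times_eq)
  qed
  ultimately show ?thesis
    by (simp add: N_def \<Delta>'_def)
qed

end
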